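(* Let $X$ be a compact metric space and $f:X\to X$ a continuous map such that $(X,f)$ has the uniform separation property and the ergodic measures of $(X,f)$ are entropy dense. Let $\varphi:X\to\mathbb{R}$ be continuous. Then for any $f$-invariant Borel probability measure $\mu$ on $X$ (not necessarily ergodic), the quantities $SP_\mu(f,\varphi)$ and $SP'_\mu(f,\varphi)$ exist (that is, $\underline{SP}_\mu(f,\varphi)=\overline{SP}_\mu(f,\varphi)$ and $\underline{SP}'_\mu(f,\varphi)=\overline{SP}'_\mu(f,\varphi)$), and $$SP_\mu(f,\varphi)=SP'_\mu(f,\varphi)=h_\mu(f)+\int_X\varphi\,d\mu .$$
   Context: Let $d$ be the metric on $X$, $d_n(x,y)=\max\{d(f^ix,f^iy):0\le i<n\}$, $S_n\varphi(x)=\sum_{i=0}^{n-1}\varphi(f^ix)$, and $h_\mu(f)$ the Kolmogorov–Sinai entropy. $\mathcal{M}(X)$ is the space of Borel probability measures on $X$ with the weak-star topology; $\mathcal{M}(X,f)$ and $\mathcal{E}(X,f)$ are the subsets of $f$-invariant, respectively ergodic $f$-invariant, measures. A set $E\subset X$ is $(n,\epsilon)$-separated if $d_n(x,y)>\epsilon$ for all distinct $x,y\in E$. For $\delta>0$, a set $A\subset X$ is $(\delta,n,\epsilon)$-separated if $\#\{j:0\le j\le n-1,\ d(f^jx,f^jy)>\epsilon\}\ge\delta n$ for all distinct $x,y\in A$. Let $\mathcal{E}_n(x)=\frac1n\sum_{k=0}^{n-1}\delta_{f^kx}$ and, for $F\subset\mathcal{M}(X)$, $X_{n,F}=\{x\in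 X:\mathcal{E}_n(x)\in F\}$. Let $N(F;\delta,n,\epsilon)$ be the maximal cardinality of a $(\delta,n,\epsilon)$-separated subset of $X_{n,F}$. Uniform separation property: for any $\eta>0$ there exist $\delta^*>0$, $\epsilon^*>0$ such that for each $\mu\in\mathcal{E}(X,f)$ and each neighbourhood $F\subset\mathcal{M}(X)$ of $\mu$ there is $n^*_{F,\mu,\eta}\in\mathbb{N}$ with $N(F;\delta^*,n,\epsilon^* )\ge e^{n(h_\mu(f)-\eta)}$ for all $n\ge n^*_{F,\mu,\eta}$. The ergodic measures are entropy dense if for each $\nu\in\mathcal{M}(X,f)$, each neighbourhood $F\subset\mathcal{M}(X)$ of $\nu$ and each $h^*<h_\nu(f)$ there is an ergodic measure $\mu\in F$ with $h^*<h_\mu(f)$. Define $$P(F;\varphi,n,\epsilon)=\sup\Big\{\sum_{x\in E}e^{S_n\varphi(x)}:E\subset X_{n,F}\text{ is }(n,\epsilon)\text{-separated}\Big\},$$ and $P(F;\varphi,\delta,n,\epsilon)$ likewise with $(\delta,n,\epsilon)$-separated sets in place of $(n,\epsilon)$-separated sets. With the infimum over neighbourhoods $F$ of $\mu$ in $\mathcal{M}(X)$ (equivalently, over any base of neighbourhoods of $\mu$), define $$\overline{SP}_\mu(f,\varphi)=\lim_{\epsilon\to0}\inf_{F\ni\mu}\limsup_{n\to\infty}\frac1n\log P(F;\varphi,n,\epsilon),\qquad \underline{SP}_\mu(f,\varphi)=\lim_{\epsilon\to0}\inf_{F\ni\mu}\liminf_{n\to\infty}\frac1n\log P(F;\varphi,n,\epsilon),$$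 $$\overline{SP}'_\mu(f,\varphi)=\lim_{\epsilon\to0}\lim_{\delta\to0}\inf_{F\ni\mu}\limsup_{n\to\infty}\frac1n\log P(F;\varphi,\delta,n,\epsilon),\qquad \underline{SP}'_\mu(f,\varphi)=\lim_{\epsilon\to0}\lim_{\delta\to0}\inf_{F\ni\mu}\liminf_{n\to\infty}\frac1n\log P(F;\varphi,\delta,n,\epsilon).$$ When the upper and lower quantities coincide, the common values are denoted $SP_\mu(f,\varphi)$ and $SP'_\mu(f,\varphi)$ respectively. *)

theory Defs
  imports "HOL-Probability.Probability"
begin

text \<open>The space \<open>X\<close> is the universe of a metric type; its compactness is a hypothesis of
  the theorem. Logarithms are natural; \<open>log 0 = -\<infinity>\<close> is needed because \<open>X\<^sub>n\<^sub>,\<^sub>F\<close> may be empty.\<close>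

definition ereal_exp :: "ereal \<Rightarrow> ereal" where
  "ereal_exp x = (case x of ereal r \<Rightarrow> ereal (exp r) | PInfty \<Rightarrow> \<infinity> | MInfty \<Rightarrow> 0)"

definition ereal_ln :: "ereal \<Rightarrow> ereal" where
  "ereal_ln x = (if x \<le> 0 then -\<infinity> else if x = \<infinity> then \<infinity> else ereal (ln (real_of_ereal x)))"


subsection \<open>Measures and the weak-star topology\<close>

definition prob_measures :: "'a::topological_space measure set" where
  "prob_measures = {M. sets M = sets borel \<and> prob_space M}"

definition invariant_measures :: "('a \<Rightarrow> 'a) \<Rightarrow> 'a::topological_space measure set" where
  "invariant_measures f = {M \<in> prob_measures. distr M borel f = M}"

definition ergodic_measures :: "('a \<Rightarrow> 'a) \<Rightarrow> 'a::topological_space measure set" where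
  "ergodic_measures f = {M \<in> invariant_measures f.
     \<forall>A \<in> sets borel. f -` A = A \<longrightarrow> measure M A = 0 \<or> measure M A = 1}"

text \<open>The coarsest topology on the probability measures making \<open>M \<mapsto> \<integral> g dM\<close> continuous for all
  bounded continuous \<open>g\<close>; on a compact space boundedness is automatic.\<close>

definition weak_star :: "'a::topological_space measure topology" where
  "weak_star = topology_generated_by
     {{M \<in> prob_measures. integral\<^sup>L M g \<in> U} |g U.
        continuous_on UNIV (g :: 'a \<Rightarrow> real) \<and> bounded (range g) \<and> open U}"

text \<open>Neighbourhoods need not be open.\<close>

definition nbhds_of :: "'a::topological_space measure \<Rightarrow> 'a measure set set" where
  "nbhds_of M = {F. F \<subseteq> prob_measures \<and> (\<exists>U. openin weak_star U \<and> M \<in> U \<and> U \<subseteq> F)}"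

lemma topspace_weak_star: "topspace weak_star = prob_measures"
proof -
  have "prob_measures \<in>
      {{M \<in> prob_measures. integral\<^sup>L M g \<in> U} |g U.
        continuous_on UNIV (g :: 'a \<Rightarrow> real) \<and> bounded (range g) \<and> open U}"
    by (rule CollectI, rule exI[of _ "\<lambda>_. 0"], rule exI[of _ UNIV]) auto
  then show ?thesis
    unfolding weak_star_def topology_generated_by_topspace by auto
qed


subsection \<open>Kolmogorov--Sinai entropy\<close>

definition finite_partitions :: "'a::topological_space set set set" where
  "finite_partitions = {P. finite P \<and> P \<subseteq> sets borel \<and> partition_on UNIV P}"

text \<open>Terms with \<open>\<mu>(A) = 0\<close> vanish, as \<open>0 * ln 0 = 0\<close>.\<close>

definition partition_entropy :: "'a measure \<Rightarrow> 'a set set \<Rightarrow> real" where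
  "partition_entropy M P = - (\<Sum>A\<in>P. measure M A * ln (measure M A))"

text \<open>The cells of \<open>P \<or> f\<^sup>-\<^sup>1P \<or> \<dots> \<or> f\<^sup>-\<^sup>(\<^sup>n\<^sup>-\<^sup>1\<^sup>)P\<close>, plus possibly the empty set.\<close>

definition iterated_join :: "('a \<Rightarrow> 'a) \<Rightarrow> 'a set set \<Rightarrow> nat \<Rightarrow> 'a set set" where
  "iterated_join f P n = {(\<Inter>i<n. (f ^^ i) -` A i) |A. \<forall>i<n. A i \<in> P}"

text \<open>For invariant measures the limit exists by subadditivity.\<close>

definition ks_entropy :: "('a \<Rightarrow> 'a) \<Rightarrow> 'a::topological_space measure \<Rightarrow> ereal" where
  "ks_entropy f M =
     (SUP P\<in>finite_partitions. lim (\<lambda>n. ereal (partition_entropy M (iterated_join f P n) / real n)))"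


subsection \<open>Separated sets and empirical measures\<close>

definition bowen_dist :: "('a::metric_space \<Rightarrow> 'a) \<Rightarrow> nat \<Rightarrow> 'a \<Rightarrow> 'a \<Rightarrow> real" where
  "bowen_dist f n x y = Max ((\<lambda>i. dist ((f ^^ i) x) ((f ^^ i) y)) ` {..<n})"

definition birkhoff_sum :: "('a \<Rightarrow> 'a) \<Rightarrow> ('a \<Rightarrow> real) \<Rightarrow> nat \<Rightarrow> 'a \<Rightarrow> real" where
  "birkhoff_sum f \<phi> n x = (\<Sum>i<n. \<phi> ((f ^^ i) x))"

definition separated :: "('a::metric_space \<Rightarrow> 'a) \<Rightarrow> nat \<Rightarrow> real \<Rightarrow> 'a set \<Rightarrow> bool" where
  "separated f n \<epsilon> E \<longleftrightarrow> pairwise (\<lambda>x y. bowen_dist f n x y > \<epsilon>) E"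

definition delta_separated :: "('a::metric_space \<Rightarrow> 'a) \<Rightarrow> real \<Rightarrow> nat \<Rightarrow> real \<Rightarrow> 'a set \<Rightarrow> bool" where
  "delta_separated f \<delta> n \<epsilon> A \<longleftrightarrow>
     pairwise (\<lambda>x y. real (card {j. j < n \<and> dist ((f ^^ j) x) ((f ^^ j) y) > \<epsilon>}) \<ge> \<delta> * real n) A"

text \<open>The push-forward of the uniform distribution on \<open>{0, \<dots>, n - 1}\<close> along the orbit of \<open>x\<close>;
  the lemma below gives the formula as an average of Dirac measures.\<close>

definition empirical_measure ::
    "('a \<Rightarrow> 'a) \<Rightarrow> nat \<Rightarrow> 'a::topological_space \<Rightarrow> 'a measure" where
  "empirical_measure f n x = distr (uniform_count_measure {..<n}) borel (\<lambda>k. (f ^^ k) x)"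

lemma measure_empirical_measure:
  assumes A: "A \<in> sets borel"
  shows "measure (empirical_measure f n x) A =
    (1 / real n) * (\<Sum>k<n. measure (return borel ((f ^^ k) x)) A)"
proof -
  have [measurable]: "(\<lambda>k. (f ^^ k) x) \<in> uniform_count_measure {..<n} \<rightarrow>\<^sub>M borel"
    by (auto simp: measurable_def space_uniform_count_measure sets_uniform_count_measure)
  have "measure (empirical_measure f n x) A =
      measure (uniform_count_measure {..<n}) ((\<lambda>k. (f ^^ k) x) -` A \<inter> {..<n})"
    unfolding empirical_measure_def
    by (subst measure_distr) (use A in \<open>auto simp: space_uniform_count_measure\<close>)
  also have "\<dots> = card ((\<lambda>k. (f ^^ k) x) -` A \<inter> {..<n}) / real n"
    by (subst measure_uniform_count_measure) auto
  also have "real (card ((\<lambda>k. (f ^^ k) x) -` A \<inter> {..<n})) = (\<Sum>k<n. indicator A ((f ^^ k) x))"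
    by (simp add: indicator_def sum.If_cases vimage_def Int_commute)
  finally show ?thesis
    using A by (simp add: measure_return)
qed

definition emp_set :: "('a \<Rightarrow> 'a) \<Rightarrow> nat \<Rightarrow> 'a::topological_space measure set \<Rightarrow> 'a set" where
  "emp_set f n F = {x. empirical_measure f n x \<in> F}"

text \<open>In the suprema below restricting to finite sets loses nothing: a subset of a separated set is
  separated and the summands are positive. (On a compact space with \<open>n, \<delta>, \<epsilon> > 0\<close> and \<open>f\<close>
  continuous all separated sets are finite, and the supremum in \<open>max_separated\<close> is a maximum.)\<close>

definition max_separated ::
    "('a::metric_space \<Rightarrow> 'a) \<Rightarrow> 'a measure set \<Rightarrow> real \<Rightarrow> nat \<Rightarrow> real \<Rightarrow> ereal" where
  "max_separated f F \<delta> n \<epsilon> =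
     (SUP A\<in>{A. finite A \<and> A \<subseteq> emp_set f n F \<and> delta_separated f \<delta> n \<epsilon> A}. ereal (real (card A)))"

definition sep_sum ::
    "('a::metric_space \<Rightarrow> 'a) \<Rightarrow> 'a measure set \<Rightarrow> ('a \<Rightarrow> real) \<Rightarrow> nat \<Rightarrow> real \<Rightarrow> ereal" where
  "sep_sum f F \<phi> n \<epsilon> =
     (SUP E\<in>{E. finite E \<and> E \<subseteq> emp_set f n F \<and> separated f n \<epsilon> E}.
        ereal (\<Sum>x\<in>E. exp (birkhoff_sum f \<phi> n x)))"

definition delta_sep_sum ::
    "('a::metric_space \<Rightarrow> 'a) \<Rightarrow> 'a measure set \<Rightarrow> ('a \<Rightarrow> real) \<Rightarrow> real \<Rightarrow> nat \<Rightarrow> real \<Rightarrow> ereal" where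
  "delta_sep_sum f F \<phi> \<delta> n \<epsilon> =
     (SUP E\<in>{E. finite E \<and> E \<subseteq> emp_set f n F \<and> delta_separated f \<delta> n \<epsilon> E}.
        ereal (\<Sum>x\<in>E. exp (birkhoff_sum f \<phi> n x)))"


subsection \<open>The two hypotheses on the system\<close>

definition uniform_separation :: "('a::metric_space \<Rightarrow> 'a) \<Rightarrow> bool" where
  "uniform_separation f \<longleftrightarrow>
     (\<forall>\<eta>>0. \<exists>\<delta>>0. \<exists>\<epsilon>>0. \<forall>\<mu>\<in>ergodic_measures f. \<forall>F\<in>nbhds_of \<mu>. \<exists>n0. \<forall>n\<ge>n0.
        max_separated f F \<delta> n \<epsilon> \<ge> ereal_exp (ereal (real n) * (ks_entropy f \<mu> - ereal \<eta>)))"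

definition entropy_dense :: "('a::metric_space \<Rightarrow> 'a) \<Rightarrow> bool" where
  "entropy_dense f \<longleftrightarrow>
     (\<forall>\<nu>\<in>invariant_measures f. \<forall>F\<in>nbhds_of \<nu>. \<forall>h::real. ereal h < ks_entropy f \<nu> \<longrightarrow>
        (\<exists>\<mu>\<in>ergodic_measures f. \<mu> \<in> F \<and> ereal h < ks_entropy f \<mu>))"


subsection \<open>Measure-theoretic pressure through separated sets\<close>

text \<open>All limits in \<open>\<epsilon>\<close> and \<open>\<delta>\<close> exist in the extended reals, the quantities being monotone.\<close>

definition SP_upper ::
    "('a::metric_space \<Rightarrow> 'a) \<Rightarrow> ('a \<Rightarrow> real) \<Rightarrow> 'a measure \<Rightarrow> ereal" where
  "SP_upper f \<phi> \<mu> = Lim (at_right 0) (\<lambda>\<epsilon>. INF F\<in>nbhds_of \<mu>.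
     limsup (\<lambda>n. ereal_ln (sep_sum f F \<phi> n \<epsilon>) / ereal (real n)))"

definition SP_lower ::
    "('a::metric_space \<Rightarrow> 'a) \<Rightarrow> ('a \<Rightarrow> real) \<Rightarrow> 'a measure \<Rightarrow> ereal" where
  "SP_lower f \<phi> \<mu> = Lim (at_right 0) (\<lambda>\<epsilon>. INF F\<in>nbhds_of \<mu>.
     liminf (\<lambda>n. ereal_ln (sep_sum f F \<phi> n \<epsilon>) / ereal (real n)))"

definition SP'_upper ::
    "('a::metric_space \<Rightarrow> 'a) \<Rightarrow> ('a \<Rightarrow> real) \<Rightarrow> 'a measure \<Rightarrow> ereal" where
  "SP'_upper f \<phi> \<mu> = Lim (at_right 0) (\<lambda>\<epsilon>. Lim (at_right 0) (\<lambda>\<delta>. INF F\<in>nbhds_of \<mu>.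
     limsup (\<lambda>n. ereal_ln (delta_sep_sum f F \<phi> \<delta> n \<epsilon>) / ereal (real n))))"

definition SP'_lower ::
    "('a::metric_space \<Rightarrow> 'a) \<Rightarrow> ('a \<Rightarrow> real) \<Rightarrow> 'a measure \<Rightarrow> ereal" where
  "SP'_lower f \<phi> \<mu> = Lim (at_right 0) (\<lambda>\<epsilon>. Lim (at_right 0) (\<lambda>\<delta>. INF F\<in>nbhds_of \<mu>.
     liminf (\<lambda>n. ereal_ln (delta_sep_sum f F \<phi> \<delta> n \<epsilon>) / ereal (real n))))"

end

theory Submission
  imports Defs
begin

text \<open>The lower bound for \<open>SP'\<close> follows from entropy density: a small neighbourhood of \<open>\<mu>\<close>
  contains an ergodic measure of almost the same entropy, uniform separation provides many orbits
  whose empirical measures lie in that neighbourhood, and there \<open>S\<^sub>n\<phi> \<approx> n \<integral>\<phi> d\<mu>\<close>. The upper bound for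
  \<open>SP\<close> needs neither ergodicity nor upper semicontinuity of the entropy. Fix \<open>\<epsilon>\<close> and a partition \<open>P\<close> into
  sets of diameter less than \<open>\<epsilon>\<close> with \<open>\<mu>\<close>-null frontiers. Points of an \<open>(n, \<epsilon>)\<close>-separated set have
  distinct itineraries, and if the empirical measures are close to \<open>\<mu>\<close> on the cells of
  \<open>P\<^sup>m = P \<or> \<dots> \<or> f\<^sup>-\<^sup>(\<^sup>m\<^sup>-\<^sup>1\<^sup>)P\<close>, then coding itineraries by \<open>m\<close>-blocks weighted by \<open>\<mu>\<close> shows that there are
  at most about \<open>exp (n H\<^sub>\<mu>(P\<^sup>m) / m)\<close> of them. All four quantities are squeezed between the two bounds.\<close>

section \<open>Invariant measures and preimages under iterates\<close>

lemma prob_measuresD: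
  assumes "M \<in> prob_measures"
  shows "prob_space M" "sets M = sets borel" "space M = UNIV"
  using assms sets_eq_imp_space_eq[of M borel] by (auto simp: prob_measures_def)

lemma invariant_measuresD:
  assumes "M \<in> invariant_measures f"
  shows "M \<in> prob_measures" "distr M borel f = M"
  using assms by (auto simp: invariant_measures_def)

lemma invariant_measure_vimage:
  assumes M: "M \<in> invariant_measures f" and f: "f \<in> borel_measurable borel" and A: "A \<in> sets borel"
  shows "measure M (f -` A) = measure M A"
proof -
  note P = prob_measuresD[OF invariant_measuresD(1)[OF M]]
  have "measure M A = measure (distr M borel f) A"
    using invariant_measuresD(2)[OF M] by simp
  also have "\<dots> = measure M (f -` A \<inter> space M)"
    using f A P by (intro measure_distr) (auto simp: measurable_def)
  finally show ?thesis using P by simp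
qed

lemma funpow_borel_measurable:
  fixes f :: "'a::topological_space \<Rightarrow> 'a"
  assumes "f \<in> borel_measurable borel"
  shows "(f ^^ n) \<in> borel_measurable borel"
proof (induction n)
  case (Suc n)
  from measurable_comp[OF this assms] show ?case by (simp add: o_def)
qed (simp add: id_def)

lemma invariant_measure_vimage_funpow:
  assumes M: "M \<in> invariant_measures f" and f: "f \<in> borel_measurable borel" and A: "A \<in> sets borel"
  shows "measure M ((f ^^ n) -` A) = measure M A"
proof (induction n)
  case (Suc n)
  have *: "(f ^^ n) -` A \<in> sets borel"
    using funpow_borel_measurable[OF f, of n] A by (auto simp: measurable_def)
  have "(f ^^ Suc n) -` A = f -` ((f ^^ n) -` A)"
    unfolding funpow_Suc_right by (simp add: vimage_comp funpow_Suc_right[symmetric])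
  then show ?case
    using invariant_measure_vimage[OF M f *] Suc.IH by (simp del: funpow.simps)
qed simp

subsection \<open>Subadditive sequences and entropy of partitions\<close>

lemma subadditive_mult_le:
  fixes u :: "nat \<Rightarrow> real"
  assumes sub: "\<And>m n. u (m + n) \<le> u m + u n"
  shows "u (q * m + r) \<le> real q * u m + u r"
proof (induction q)
  case (Suc q)
  have "u (Suc q * m + r) \<le> u m + u (q * m + r)"
    using sub[of m "q * m + r"] by (simp add: algebra_simps)
  with Suc.IH show ?case by (simp add: algebra_simps)
qed simp

text \<open>Division with remainder, n = q m + r with r < m, shows that u n / n exceeds u m / m by
  at most a bounded term over n. Nonnegativity keeps the infimum from being degenerate, so the limit
  is real.\<close>

lemma Fekete:
  fixes u :: "nat \<Rightarrow> real"
  assumes sub: "\<And>m n. u (m + n) \<le> u m + u n" and nonneg: "\<And>n. 0 \<le> u n"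
  shows "(\<lambda>n. u n / real n) \<longlonglongrightarrow> (INF n\<in>{1..}. u n / real n)"
proof -
  define L where "L = (INF n\<in>{1..}. u n / real n)"
  have bdd: "bdd_below ((\<lambda>n. u n / real n) ` {1..})"
    by (rule bdd_belowI[of _ 0]) (auto simp: nonneg)
  have lower: "L \<le> u n / real n" if "n \<ge> 1" for n
    unfolding L_def using that by (intro cINF_lower bdd) auto
  have "(\<lambda>n. u n / real n) \<longlonglongrightarrow> L"
  proof (rule order_tendstoI)
    fix a assume "a < L"
    then show "\<forall>\<^sub>F n in sequentially. a < u n / real n"
      by (intro eventually_sequentiallyI[of 1]) (use lower in fastforce)
  next
    fix a assume "L < a"
    then obtain m where m: "m \<ge> 1" "u m / real m < a"
      unfolding L_def using cINF_less_iff[OF _ bdd, of a] by auto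
    define C where "C = (\<Sum>r<m. u r)"
    have C: "u r \<le> C" if "r < m" for r
      unfolding C_def using that by (intro member_le_sum) (auto simp: nonneg)
    have bound: "u n / real n \<le> u m / real m + C / real n" if "n \<ge> 1" for n
    proof -
      have "u n \<le> real (n div m) * u m + u (n mod m)"
        using subadditive_mult_le[of u "n div m" m "n mod m", OF sub] by simp
      also have "\<dots> \<le> real n / real m * u m + C"
      proof (intro add_mono mult_right_mono nonneg)
        show "real (n div m) \<le> real n / real m"
          using m(1) div_times_less_eq_dividend[of n m]
          by (simp add: le_divide_eq flip: of_nat_mult)
      qed (use m(1) C[of "n mod m"] in auto)
      finally show ?thesis
        using that by (simp add: field_simps)
    qed
    have "(\<lambda>n. u m / real m + C / real n) \<longlonglongrightarrow> u m / real m + 0"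
      by (intro tendsto_intros lim_const_over_n)
    then have "\<forall>\<^sub>F n in sequentially. u m / real m + C / real n < a"
      using m(2) by (intro order_tendstoD) auto
    then show "\<forall>\<^sub>F n in sequentially. u n / real n < a"
      using eventually_ge_at_top[of 1] by eventually_elim (use bound in fastforce)
  qed
  then show ?thesis unfolding L_def .
qed

section \<open>Joins of partitions and subadditivity of their entropy\<close>

lemma measure_sum_Int_partition:
  assumes M: "M \<in> prob_measures" and Q: "finite Q" "disjoint Q" "\<Union>Q = UNIV" "Q \<subseteq> sets borel"
    and A: "A \<in> sets borel"
  shows "(\<Sum>B\<in>Q. measure M (A \<inter> B)) = measure M A"
proof -
  interpret prob_space M using prob_measuresD[OF M] by simp
  have "measure M (\<Union>B\<in>Q. A \<inter> B) = (\<Sum>B\<in>Q. measure M (A \<inter> B))"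
    using Q A prob_measuresD[OF M]
    by (intro finite_measure_finite_Union) (auto simp: disjoint_family_on_def disjoint_def)
  moreover have "(\<Union>B\<in>Q. A \<inter> B) = A" using Q(3) by auto
  ultimately show ?thesis by simp
qed

lemma measure_sum_partition:
  assumes M: "M \<in> prob_measures" and Q: "finite Q" "disjoint Q" "\<Union>Q = UNIV" "Q \<subseteq> sets borel"
  shows "(\<Sum>B\<in>Q. measure M B) = 1"
proof -
  interpret prob_space M using prob_measuresD[OF M] by simp
  show ?thesis
    using measure_sum_Int_partition[OF assms, of UNIV] prob_space prob_measuresD[OF M] by simp
qed

text \<open>The facts stop short of \<open>partition_on\<close> because a join may contain the empty
  cell. Disjointness holds since two distinct cells differ in some letter, and distinct members of
  \<open>P\<close> are disjoint.\<close>

lemma iterated_join_partition: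
  assumes f: "f \<in> borel_measurable borel" and P: "P \<in> finite_partitions"
  shows "finite (iterated_join f P n)" "disjoint (iterated_join f P n)"
    "\<Union>(iterated_join f P n) = UNIV" "iterated_join f P n \<subseteq> sets borel"
proof -
  have P': "finite P" "disjoint P" "\<Union>P = UNIV" "P \<subseteq> sets borel"
    using P by (auto simp: finite_partitions_def partition_on_def)
  have "iterated_join f P n \<subseteq> (\<lambda>A. \<Inter>i<n. (f ^^ i) -` A i) ` ({..<n} \<rightarrow>\<^sub>E P)"
  proof
    fix C assume "C \<in> iterated_join f P n"
    then obtain A where A: "C = (\<Inter>i<n. (f ^^ i) -` A i)" "\<forall>i<n. A i \<in> P"
      by (auto simp: iterated_join_def)
    then show "C \<in> (\<lambda>A. \<Inter>i<n. (f ^^ i) -` A i) ` ({..<n} \<rightarrow>\<^sub>E P)"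
      by (intro image_eqI[of _ _ "restrict A {..<n}"]) auto
  qed
  then show "finite (iterated_join f P n)"
    by (rule finite_subset) (auto intro!: finite_imageI finite_PiE P')
  show "disjoint (iterated_join f P n)"
  proof (rule disjointI)
    fix C D assume "C \<in> iterated_join f P n" "D \<in> iterated_join f P n" "C \<noteq> D"
    then obtain A B where A: "C = (\<Inter>i<n. (f ^^ i) -` A i)" "\<forall>i<n. A i \<in> P"
      and B: "D = (\<Inter>i<n. (f ^^ i) -` B i)" "\<forall>i<n. B i \<in> P"
      by (auto simp: iterated_join_def)
    have "\<exists>i<n. A i \<noteq> B i" using A B \<open>C \<noteq> D\<close> by auto
    then obtain i where i: "i < n" "A i \<noteq> B i" by auto
    then have "A i \<inter> B i = {}" using A B P'(2) by (auto simp: disjoint_def)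
    then show "C \<inter> D = {}" using A B i by blast
  qed
  show "\<Union>(iterated_join f P n) = UNIV"
  proof (rule set_eqI, simp)
    fix x
    have "\<exists>A. A \<in> P \<and> (f ^^ i) x \<in> A" for i using P'(3) by blast
    then obtain A where "\<And>i. A i \<in> P \<and> (f ^^ i) x \<in> A i" by metis
    then show "\<exists>C\<in>iterated_join f P n. x \<in> C"
      by (intro bexI[of _ "\<Inter>i<n. (f ^^ i) -` A i"]) (auto simp: iterated_join_def)
  qed
  show "iterated_join f P n \<subseteq> sets borel"
  proof
    fix C assume "C \<in> iterated_join f P n"
    then obtain A where A: "C = (\<Inter>i<n. (f ^^ i) -` A i)" "\<forall>i<n. A i \<in> P"
      by (auto simp: iterated_join_def)
    have "(f ^^ i) -` A i \<in> sets borel" if "i < n" for i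
      using funpow_borel_measurable[OF f, of i] A(2) P'(4) that by (auto simp: measurable_def)
    then show "C \<in> sets borel"
      unfolding A(1) by (cases "n = 0") (auto intro!: sets.finite_INT)
  qed
qed

text \<open>A word of n + m letters is a word of n letters followed by one of m letters read after
  applying \<open>f ^^ n\<close>. The two words can be chosen independently, so the full product
  appears.\<close>

lemma iterated_join_add:
  "iterated_join f P (n + m) =
    (\<lambda>(A, B). A \<inter> (f ^^ n) -` B) ` (iterated_join f P n \<times> iterated_join f P m)"
proof -
  have split: "(\<Inter>i<n + m. (f ^^ i) -` A i) =
      (\<Inter>i<n. (f ^^ i) -` A i) \<inter> (f ^^ n) -` (\<Inter>i<m. (f ^^ i) -` A (n + i))" for A :: "nat \<Rightarrow> 'a set"
  proof (rule set_eqI)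
    fix x
    have "(\<forall>i<n + m. (f ^^ i) x \<in> A i) \<longleftrightarrow>
      (\<forall>i<n. (f ^^ i) x \<in> A i) \<and> (\<forall>i<m. (f ^^ i) ((f ^^ n) x) \<in> A (n + i))" (is "?l \<longleftrightarrow> ?r")
    proof
      assume ?l then show ?r
        by (auto simp flip: funpow_add[THEN fun_cong, unfolded o_apply] simp: add.commute)
    next
      assume r: ?r
      show ?l
      proof (intro allI impI)
        fix i assume i: "i < n + m"
        show "(f ^^ i) x \<in> A i"
        proof (cases "i < n")
          case False
          then have "i - n < m" "i - n + n = i" "n + (i - n) = i" using i by auto
          then show ?thesis
            using r funpow_add[of "i - n" n f] by (metis o_apply)
        qed (use r in auto)
      qed
    qed
    then show "x \<in> (\<Inter>i<n + m. (f ^^ i) -` A i) \<longleftrightarrow>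
      x \<in> (\<Inter>i<n. (f ^^ i) -` A i) \<inter> (f ^^ n) -` (\<Inter>i<m. (f ^^ i) -` A (n + i))"
      by auto
  qed
  show ?thesis
  proof (rule set_eqI, rule iffI)
    fix C assume "C \<in> iterated_join f P (n + m)"
    then obtain A where A: "C = (\<Inter>i<n + m. (f ^^ i) -` A i)" "\<forall>i<n + m. A i \<in> P"
      by (auto simp: iterated_join_def)
    let ?p = "(\<Inter>i<n. (f ^^ i) -` A i, \<Inter>i<m. (f ^^ i) -` A (n + i))"
    have "?p \<in> iterated_join f P n \<times> iterated_join f P m"
      using A(2) by (auto simp: iterated_join_def)
    then show "C \<in> (\<lambda>(A, B). A \<inter> (f ^^ n) -` B) ` (iterated_join f P n \<times> iterated_join f P m)"
      unfolding A(1) split by (intro image_eqI[of _ _ ?p]) auto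
  next
    fix C assume "C \<in> (\<lambda>(A, B). A \<inter> (f ^^ n) -` B) ` (iterated_join f P n \<times> iterated_join f P m)"
    then obtain A B where AB: "\<forall>i<n. A i \<in> P" "\<forall>i<m. B i \<in> P"
      and C: "C = (\<Inter>i<n. (f ^^ i) -` A i) \<inter> (f ^^ n) -` (\<Inter>i<m. (f ^^ i) -` B i)"
      by (auto simp: iterated_join_def)
    define D where "D i = (if i < n then A i else B (i - n))" for i
    have "C = (\<Inter>i<n + m. (f ^^ i) -` D i)"
      unfolding split C by (auto simp: D_def)
    moreover have "\<forall>i<n + m. D i \<in> P" using AB by (auto simp: D_def)
    ultimately show "C \<in> iterated_join f P (n + m)"
      by (auto simp: iterated_join_def)
  qed
qed

text \<open>This is ln t \<le> t - 1 at t = q / p, multiplied by p; summed over two probability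
  vectors it becomes Gibbs' inequality. Because of the convention \<open>ln 0 = 0\<close>, the case
  q = 0 < p has to be excluded.\<close>

lemma Gibbs_term:
  fixes p q :: real
  assumes "0 \<le> p" "0 \<le> q" "q = 0 \<Longrightarrow> p = 0"
  shows "p * ln q - p * ln p \<le> q - p"
proof (cases "p = 0")
  case False
  then have pq: "p > 0" "q > 0" using assms by force+
  have "p * ln q - p * ln p = p * ln (q / p)"
    using pq by (simp add: ln_div algebra_simps)
  also have "\<dots> \<le> p * (q / p - 1)"
    using pq by (intro mult_left_mono ln_le_minus_one) auto
  also have "\<dots> = q - p"
    using pq by (simp add: right_diff_distrib)
  finally show ?thesis .
qed (use assms in simp)

text \<open>The joint distribution \<open>p\<close> of the first n and the following m letters has
  nonnegative relative entropy with respect to the product of its marginals. Invariance identifies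
  the second marginal with the cell measures of the m-fold join.\<close>

lemma partition_entropy_join_le:
  assumes f: "f \<in> borel_measurable borel" and M: "M \<in> invariant_measures f" and P: "P \<in> finite_partitions"
  shows "partition_entropy M (iterated_join f P (n + m)) \<le>
    partition_entropy M (iterated_join f P n) + partition_entropy M (iterated_join f P m)"
proof -
  note Mp = invariant_measuresD(1)[OF M]
  interpret prob_space M using prob_measuresD[OF Mp] by simp
  define Q where "Q = iterated_join f P n"
  define R where "R = iterated_join f P m"
  note Qp = iterated_join_partition[OF f P, of n, folded Q_def]
  note Rp = iterated_join_partition[OF f P, of m, folded R_def]
  define h where "h = (\<lambda>(A, B). A \<inter> (f ^^ n) -` B)"
  define p where "p = (\<lambda>z. measure M (h z))"
  have vim: "(f ^^ n) -` B \<in> sets borel" if "B \<in> sets borel" for B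
    using funpow_borel_measurable[OF f, of n] that by (auto simp: measurable_def)
  have meas_vim: "measure M ((f ^^ n) -` B) = measure M B" if "B \<in> R" for B
    using invariant_measure_vimage_funpow[OF M f] that Rp(4) by auto
  have marg1: "(\<Sum>B\<in>R. p (A, B)) = measure M A" if "A \<in> Q" for A
  proof -
    have "measure M (\<Union>B\<in>R. A \<inter> (f ^^ n) -` B) = (\<Sum>B\<in>R. measure M (A \<inter> (f ^^ n) -` B))"
    proof (rule finite_measure_finite_Union)
      show "(\<lambda>B. A \<inter> (f ^^ n) -` B) ` R \<subseteq> sets M"
        using Rp(4) Qp(4) that vim prob_measuresD(2)[OF Mp] by blast
      show "disjoint_family_on (\<lambda>B. A \<inter> (f ^^ n) -` B) R"
        using Rp(2) unfolding disjoint_family_on_def disjoint_def by blast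
    qed (rule Rp)
    moreover have "(\<Union>B\<in>R. A \<inter> (f ^^ n) -` B) = A" using Rp(3) by auto
    ultimately show ?thesis by (simp add: p_def h_def)
  qed
  have marg2: "(\<Sum>A\<in>Q. p (A, B)) = measure M B" if "B \<in> R" for B
    using measure_sum_Int_partition[OF Mp Qp, OF vim] Rp(4) that meas_vim[OF that]
    by (simp add: p_def h_def Int_commute subset_iff)
  have p_le: "p (A, B) \<le> measure M A" "p (A, B) \<le> measure M B" if "A \<in> Q" "B \<in> R" for A B
  proof -
    have "A \<in> sets M" "(f ^^ n) -` B \<in> sets M"
      using that Qp(4) Rp(4) vim[of B] prob_measuresD(2)[OF Mp] by auto
    then show "p (A, B) \<le> measure M A" "p (A, B) \<le> measure M B"
      unfolding meas_vim[OF that(2), symmetric] by (simp_all add: p_def h_def finite_measure_mono)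
  qed
  have "partition_entropy M (iterated_join f P (n + m)) = - (\<Sum>C\<in>h ` (Q \<times> R). measure M C * ln (measure M C))"
    by (simp add: partition_entropy_def iterated_join_add Q_def R_def h_def)
  \<comment> \<open>Different pairs yield the same set only if that set is empty, and then its term
    vanishes since \<open>0 * ln 0 = 0\<close>.\<close>
  also have "(\<Sum>C\<in>h ` (Q \<times> R). measure M C * ln (measure M C)) = (\<Sum>z\<in>Q \<times> R. p z * ln (p z))"
  proof -
    have "(\<Sum>C\<in>h ` (Q \<times> R). measure M C * ln (measure M C)) =
        sum ((\<lambda>C. measure M C * ln (measure M C)) \<circ> h) (Q \<times> R)"
    proof (rule sum.reindex_nontrivial)
      show "finite (Q \<times> R)" using Qp Rp by simp
      fix z w assume zw: "z \<in> Q \<times> R" "w \<in> Q \<times> R" "z \<noteq> w" "h z = h w"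
      obtain A B A' B' where [simp]: "z = (A, B)" "w = (A', B')" by (cases z, cases w)
      have "A \<inter> A' = {} \<or> B \<inter> B' = {}"
        using zw(1-3) disjointD[OF Qp(2), of A A'] disjointD[OF Rp(2), of B B'] by auto
      moreover have "h z \<subseteq> A \<inter> A'" "h z \<subseteq> (f ^^ n) -` (B \<inter> B')"
        using zw(4) unfolding h_def by auto
      ultimately have "h z = {}" by auto
      then show "measure M (h z) * ln (measure M (h z)) = 0" by simp
    qed
    then show ?thesis by (simp add: p_def)
  qed
  also have "- (\<Sum>z\<in>Q \<times> R. p z * ln (p z)) \<le>
      - (\<Sum>(A, B)\<in>Q \<times> R. p (A, B) * (ln (measure M A) + ln (measure M B)))"
  proof -
    have "(\<Sum>(A, B)\<in>Q \<times> R. p (A, B) * (ln (measure M A) + ln (measure M B)) - p (A, B) * ln (p (A, B)))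
        \<le> (\<Sum>(A, B)\<in>Q \<times> R. measure M A * measure M B - p (A, B))"
    proof (rule sum_mono, clarify)
      fix A B assume AB: "A \<in> Q" "B \<in> R"
      have p0: "0 \<le> p (A, B)" by (simp add: p_def)
      show "p (A, B) * (ln (measure M A) + ln (measure M B)) - p (A, B) * ln (p (A, B))
          \<le> measure M A * measure M B - p (A, B)"
      \<comment> \<open>A positive joint mass forces both marginals to be positive, so the logarithm
        of their product splits. Otherwise only the nonnegative product of the marginals
        remains.\<close>
      proof (cases "p (A, B) = 0")
        case False
        then have "measure M A > 0" "measure M B > 0"
          using p_le[OF AB] p0 by linarith+
        then show ?thesis
          using Gibbs_term[OF p0, of "measure M A * measure M B"] by (simp add: ln_mult)
      qed simp
    qed
    also have "\<dots> = 0"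
      using measure_sum_partition[OF Mp Qp] measure_sum_partition[OF Mp Rp]
      by (simp add: sum_subtractf sum.cartesian_product[symmetric] marg1
          flip: sum_distrib_left)
    finally show ?thesis
      by (simp add: sum_subtractf case_prod_unfold)
  qed
  also have "(\<Sum>(A, B)\<in>Q \<times> R. p (A, B) * (ln (measure M A) + ln (measure M B))) =
      (\<Sum>A\<in>Q. \<Sum>B\<in>R. p (A, B) * ln (measure M A)) + (\<Sum>B\<in>R. \<Sum>A\<in>Q. p (A, B) * ln (measure M B))"
    using sum.swap[of "\<lambda>A B. p (A, B) * ln (measure M B)" R Q]
    by (simp add: distrib_left sum.distrib flip: sum.cartesian_product)
  also have "\<dots> = (\<Sum>A\<in>Q. measure M A * ln (measure M A)) + (\<Sum>B\<in>R. measure M B * ln (measure M B))"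
    by (simp add: marg1 marg2 flip: sum_distrib_right)
  finally show ?thesis
    by (simp add: partition_entropy_def Q_def R_def)
qed

lemma partition_entropy_nonneg:
  assumes M: "M \<in> prob_measures"
  shows "0 \<le> partition_entropy M Q"
proof -
  interpret prob_space M using prob_measuresD[OF M] by simp
  have "measure M A * ln (measure M A) \<le> 0" for A
    using prob_le_1[of A] by (cases "measure M A = 0") (auto simp: mult_nonneg_nonpos zero_less_measure_iff)
  then show ?thesis
    unfolding partition_entropy_def by (simp add: sum_nonpos)
qed

text \<open>Subadditivity makes the \<open>lim\<close> in the definition of the entropy a genuine
  limit, which lies below the supremum over partitions. Being less than \<open>h\<close>, it has
  sequence terms less than \<open>h\<close>.\<close>

lemma partition_entropy_rate_le_ks_entropy:
  assumes f: "f \<in> borel_measurable borel" and M: "M \<in> invariant_measures f"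
    and P: "P \<in> finite_partitions" and h: "ks_entropy f M < ereal h"
  shows "\<exists>m\<ge>1. partition_entropy M (iterated_join f P m) / real m < h"
proof -
  define u where "u n = partition_entropy M (iterated_join f P n)" for n
  define L where "L = (INF n\<in>{1..}. u n / real n)"
  have lim: "(\<lambda>n. u n / real n) \<longlonglongrightarrow> L"
    unfolding L_def
    by (rule Fekete) (auto simp: u_def partition_entropy_join_le[OF f M P]
        partition_entropy_nonneg[OF invariant_measuresD(1)[OF M]])
  have "lim (\<lambda>n. ereal (u n / real n)) = ereal L"
    using lim by (intro limI tendsto_intros)
  then have "ereal L \<le> ks_entropy f M"
    unfolding ks_entropy_def u_def using P by (intro SUP_upper2[of P]) auto
  with h have "L < h" using le_less_trans by fastforce
  then have "\<forall>\<^sub>F n in sequentially. u n / real n < h \<and> n \<ge> 1"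
    using order_tendstoD(2)[OF lim] eventually_ge_at_top[of 1] by (auto intro: eventually_conj)
  then obtain m where "u m / real m < h" "m \<ge> 1"
    by (auto simp: eventually_sequentially)
  then show ?thesis unfolding u_def by auto
qed

subsection \<open>Neighbourhoods in the weak-star topology\<close>

lemma openin_weak_star_integral:
  fixes g :: "'a::topological_space \<Rightarrow> real"
  assumes "continuous_on UNIV g" "bounded (range g)" "open U"
  shows "openin weak_star {M \<in> prob_measures. integral\<^sup>L M g \<in> U}"
  unfolding weak_star_def using assms by (intro topology_generated_by_Basis) blast

lemma nbhds_of_integral_less:
  fixes g :: "'a::topological_space \<Rightarrow> real"
  assumes "continuous_on UNIV g" "bounded (range g)" "M \<in> prob_measures" "integral\<^sup>L M g < c"
  shows "{N \<in> prob_measures. integral\<^sup>L N g < c} \<in> nbhds_of M"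
  using openin_weak_star_integral[OF assms(1,2), of "{..<c}"] assms(3,4)
  unfolding nbhds_of_def by auto

lemma nbhds_of_Int:
  assumes "F \<in> nbhds_of M" "G \<in> nbhds_of M"
  shows "F \<inter> G \<in> nbhds_of M"
proof -
  obtain U V where "F \<subseteq> prob_measures" "openin weak_star U" "M \<in> U" "U \<subseteq> F"
    "openin weak_star V" "M \<in> V" "V \<subseteq> G"
    using assms unfolding nbhds_of_def by auto
  then show ?thesis
    unfolding nbhds_of_def by (intro CollectI conjI exI[of _ "U \<inter> V"]) auto
qed

lemma nbhds_of_mono:
  assumes "F \<in> nbhds_of M" "F \<subseteq> G" "G \<subseteq> prob_measures"
  shows "G \<in> nbhds_of M"
  using assms unfolding nbhds_of_def by blast

lemma nbhds_of_finite_ball: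
  fixes M :: "'a::topological_space measure"
  assumes "finite I" "M \<in> prob_measures" "\<And>i. i \<in> I \<Longrightarrow> {N \<in> prob_measures. R i N} \<in> nbhds_of M"
  shows "{N \<in> prob_measures. \<forall>i\<in>I. R i N} \<in> nbhds_of M"
  using assms(1,3)
proof (induction I rule: finite_induct)
  case empty
  have "openin weak_star (prob_measures :: 'a measure set)"
    using openin_topspace[of "weak_star :: 'a measure topology"] by (simp add: topspace_weak_star)
  then show ?case using assms(2) by (auto simp: nbhds_of_def)
next
  case (insert i I)
  have "{N \<in> prob_measures. \<forall>i\<in>insert i I. R i N} =
      {N \<in> prob_measures. R i N} \<inter> {N \<in> prob_measures. \<forall>i\<in>I. R i N}"
    by auto
  then show ?case using insert by (simp add: nbhds_of_Int)
qed

text \<open>Half of the portmanteau theorem: the continuous functions \<open>g k\<close> lie above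
  the indicator of \<open>A\<close> and converge to that of its closure. By dominated convergence
  some \<open>g k\<close> has \<open>M\<close>-integral below \<open>c\<close>, and bounding this
  integral for a nearby measure bounds its mass on \<open>A\<close>.\<close>

lemma nbhds_of_measure_less:
  fixes A :: "'a::metric_space set"
  assumes M: "M \<in> prob_measures" and A: "A \<in> sets borel" and c: "measure M (closure A) < c"
  shows "{N \<in> prob_measures. measure N A < c} \<in> nbhds_of M"
\<comment> \<open>\<open>infdist x {}\<close> is 0 by convention, so the functions below would not
  converge to the indicator of the empty set.\<close>
proof (cases "A = {}")
  case True
  then have "{N \<in> prob_measures. measure N A < c} = (prob_measures :: 'a measure set)"
    using c by auto
  then show ?thesis
    using nbhds_of_finite_ball[of "{}" M] M by simp
next
  case False
  interpret prob_space M using prob_measuresD[OF M] by simp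
  define g where "g k x = max 0 (1 - real k * infdist x A)" for k :: nat and x
  have g_cont: "continuous_on UNIV (g k)" for k
    unfolding g_def by (intro continuous_intros)
  have g_range: "0 \<le> g k x" "g k x \<le> 1" for k x
    by (auto simp: g_def infdist_nonneg)
  then have g_bdd: "bounded (range (g k))" for k
    by (intro boundedI[of _ 1]) auto
  have lim: "(\<lambda>k. g k x) \<longlonglongrightarrow> indicator (closure A) x" for x
  proof (cases "x \<in> closure A")
    case True
    then have "infdist x A = 0" using in_closure_iff_infdist_zero[OF False] by simp
    then show ?thesis using True by (simp add: g_def)
  next
    case notin: False
    then have pos: "infdist x A > 0"
      using in_closure_iff_infdist_zero[OF False, of x] infdist_nonneg[of x A] by linarith
    obtain K :: nat where K: "1 < real K * infdist x A"
      using pos reals_Archimedean3 by blast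
    have "g k x = 0" if "k \<ge> K" for k
    proof -
      have "real K * infdist x A \<le> real k * infdist x A"
        using that pos by (intro mult_right_mono) auto
      then show ?thesis using K by (simp add: g_def)
    qed
    then show ?thesis
      using notin by (intro tendsto_eventually eventually_sequentiallyI[of K]) auto
  qed
  have meas: "g k \<in> borel_measurable N" if "N \<in> prob_measures" for N k
    using borel_measurable_continuous_onI[OF g_cont] prob_measuresD(2)[OF that]
    by (simp cong: measurable_cong_sets)
  have "(\<lambda>k. integral\<^sup>L M (g k)) \<longlonglongrightarrow> integral\<^sup>L M (indicator (closure A))"
  proof (rule integral_dominated_convergence[where w = "\<lambda>_. 1"])
    show "indicator (closure A) \<in> borel_measurable M"
      using prob_measuresD(2)[OF M] by (intro borel_measurable_indicator) auto
  qed (use g_range lim meas[OF M] in auto)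
  moreover have "integral\<^sup>L M (indicator (closure A)) = measure M (closure A)"
    using prob_measuresD[OF M] by simp
  ultimately have "\<forall>\<^sub>F k in sequentially. integral\<^sup>L M (g k) < c"
    using c by (intro order_tendstoD(2)) auto
  then obtain k where k: "integral\<^sup>L M (g k) < c"
    by (auto simp: eventually_sequentially)
  have "measure N A \<le> integral\<^sup>L N (g k)" if N: "N \<in> prob_measures" for N
  proof -
    interpret N: prob_space N using prob_measuresD[OF N] by simp
    have "measure N A = integral\<^sup>L N (indicator A)"
      using prob_measuresD[OF N] by simp
    also have "\<dots> \<le> integral\<^sup>L N (g k)"
    proof (rule integral_mono)
      show "integrable N (indicator A :: 'a \<Rightarrow> real)"
        using A prob_measuresD[OF N] by (simp add: N.emeasure_eq_measure)
      show "integrable N (g k)"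
        using g_range meas[OF N] by (intro N.integrable_const_bound[of _ 1]) auto
      show "indicator A x \<le> g k x" for x
        using g_range by (auto simp: indicator_def g_def)
    qed
    finally show ?thesis .
  qed
  then show ?thesis
    using k by (intro nbhds_of_mono[OF nbhds_of_integral_less[OF g_cont g_bdd M k]]) force+
qed


subsection \<open>Sets with null frontier\<close>

text \<open>These are the Borel continuity sets of \<open>M\<close>. They are stable under finite
  Boolean operations and, for an invariant measure, under preimages by iterates of a continuous map,
  so the cells of a join inherit the property.\<close>

definition null_frontier :: "'a::topological_space measure \<Rightarrow> 'a set \<Rightarrow> bool" where
  "null_frontier M A \<longleftrightarrow> A \<in> sets borel \<and> measure M (frontier A) = 0"

lemma measure_eq_0_subset:
  assumes "M \<in> prob_measures" "A \<subseteq> B" "B \<in> sets borel" "measure M B = 0"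
  shows "measure M A = 0"
proof -
  interpret prob_space M using prob_measuresD[OF assms(1)] by simp
  have "measure M A \<le> measure M B"
    using assms prob_measuresD[OF assms(1)] by (intro finite_measure_mono) auto
  then show ?thesis using assms(4) measure_nonneg[of M A] by linarith
qed

lemma null_frontier_measure_closure:
  assumes M: "M \<in> prob_measures" and A: "null_frontier M A"
  shows "measure M (closure A) = measure M A"
proof -
  interpret prob_space M using prob_measuresD[OF M] by simp
  have "measure M (A \<union> frontier A) = measure M A"
    using A prob_measuresD(2)[OF M]
    by (intro measure_zero_union) (auto simp: null_frontier_def)
  then show ?thesis by (simp add: closure_Un_frontier)
qed

lemma null_frontier_Compl: "null_frontier M A \<Longrightarrow> null_frontier M (- A)"
  by (simp add: null_frontier_def borel_comp)

lemma null_frontier_Int: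
  assumes M: "M \<in> prob_measures" and "null_frontier M A" "null_frontier M B"
  shows "null_frontier M (A \<inter> B)"
proof -
  interpret prob_space M using prob_measuresD[OF M] by simp
  have "measure M (frontier A \<union> frontier B) = 0"
    using assms prob_measuresD(2)[OF M]
    by (subst measure_zero_union) (auto simp: null_frontier_def)
  then have "measure M (frontier (A \<inter> B)) = 0"
    by (intro measure_eq_0_subset[OF M frontier_Int_subset]) auto
  then show ?thesis using assms by (auto simp: null_frontier_def)
qed

lemma null_frontier_INT:
  assumes M: "M \<in> prob_measures" and "finite I" "\<And>i. i \<in> I \<Longrightarrow> null_frontier M (A i)"
  shows "null_frontier M (\<Inter>i\<in>I. A i)"
  using assms(2,3)
proof (induction I rule: finite_induct)
  case empty
  then show ?case by (simp add: null_frontier_def)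
next
  case (insert i I)
  then show ?case by (simp add: null_frontier_Int[OF M])
qed

text \<open>Preimages of closed sets are closed, so the closure of a preimage lies in the preimage
  of the closure. This is applied to \<open>A\<close> and to its complement.\<close>

lemma frontier_vimage_subset:
  fixes f :: "'a::topological_space \<Rightarrow> 'b::topological_space"
  assumes "continuous_on UNIV f"
  shows "frontier (f -` A) \<subseteq> f -` frontier A"
proof -
  have "closure (f -` B) \<subseteq> f -` closure B" for B
    using assms closure_subset[of B] by (intro closure_minimal closed_vimage) auto
  from this[of A] this[of "- A"] show ?thesis
    by (auto simp: frontier_closures vimage_Compl)
qed

lemma null_frontier_vimage_funpow:
  fixes f :: "'a::topological_space \<Rightarrow> 'a"
  assumes M: "M \<in> invariant_measures f" and f: "continuous_on UNIV f" and A: "null_frontier M A"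
  shows "null_frontier M ((f ^^ n) -` A)"
proof -
  have fm: "f \<in> borel_measurable borel" by (rule borel_measurable_continuous_onI[OF f])
  have meas: "(f ^^ n) -` B \<in> sets borel" if "B \<in> sets borel" for B
    using funpow_borel_measurable[OF fm, of n] that by (auto simp: measurable_def)
  have "continuous_on UNIV (f ^^ n)"
  proof (induction n)
    case (Suc n)
    then show ?case
      using continuous_on_compose[OF Suc continuous_on_subset[OF f]] by simp
  qed (simp add: id_def)
  then have sub: "frontier ((f ^^ n) -` A) \<subseteq> (f ^^ n) -` frontier A"
    by (rule frontier_vimage_subset)
  have "measure M ((f ^^ n) -` frontier A) = 0"
    using invariant_measure_vimage_funpow[OF M fm, of "frontier A" n] A
    by (simp add: null_frontier_def)
  then have "measure M (frontier ((f ^^ n) -` A)) = 0"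
    by (intro measure_eq_0_subset[OF invariant_measuresD(1)[OF M] sub] meas) auto
  then show ?thesis using A meas by (auto simp: null_frontier_def)
qed

lemma null_frontier_iterated_join:
  fixes f :: "'a::topological_space \<Rightarrow> 'a"
  assumes M: "M \<in> invariant_measures f" and f: "continuous_on UNIV f"
    and P: "\<And>A. A \<in> P \<Longrightarrow> null_frontier M A" and C: "C \<in> iterated_join f P n"
  shows "null_frontier M C"
proof -
  obtain A where A: "C = (\<Inter>i\<in>{..<n}. (f ^^ i) -` A i)" "\<forall>i<n. A i \<in> P"
    using C by (auto simp: iterated_join_def)
  show ?thesis
    unfolding A(1) using A(2)
    by (intro null_frontier_INT invariant_measuresD(1)[OF M] null_frontier_vimage_funpow[OF M f] P) auto
qed

text \<open>The spheres around a point are disjoint, so only countably many of them have positive measure.\<close>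

lemma null_frontier_ball:
  fixes M :: "'a::metric_space measure"
  assumes M: "M \<in> prob_measures" and e: "0 < e"
  obtains r where "0 < r" "r < e" "null_frontier M (ball x r)"
proof -
  have meas: "dist x \<in> borel_measurable M"
  proof -
    have "dist x \<in> borel_measurable borel"
      by (intro borel_measurable_continuous_onI continuous_intros)
    then show ?thesis using prob_measuresD(2)[OF M] by (simp cong: measurable_cong_sets)
  qed
  interpret prob_space M using prob_measuresD[OF M] by simp
  interpret D: prob_space "distr M borel (dist x)" by (rule prob_space_distr[OF meas])
  have "uncountable ({0<..<e} - {r. measure (distr M borel (dist x)) {r} \<noteq> 0})"
    using e D.countable_support by (intro uncountable_minus_countable) (auto simp: uncountable_open_interval)
  then have "{0<..<e} - {r. measure (distr M borel (dist x)) {r} \<noteq> 0} \<noteq> {}"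
    using countable_empty by metis
  then obtain r where r: "0 < r" "r < e" "measure (distr M borel (dist x)) {r} = 0" by auto
  have "measure M (dist x -` {r}) = 0"
    using r(3) prob_measuresD(3)[OF M] by (simp add: measure_distr[OF meas])
  moreover have "frontier (ball x r) \<subseteq> dist x -` {r}"
  proof
    fix y assume "y \<in> frontier (ball x r)"
    then have "y \<in> closure (ball x r)" "y \<notin> ball x r"
      by (auto simp: frontier_def interior_open)
    then show "y \<in> dist x -` {r}"
      using closure_minimal[OF ball_subset_cball closed_cball, of x r] by auto
  qed
  moreover have "dist x -` {r} \<in> sets borel"
    by (intro borel_closed closed_vimage) (auto intro: continuous_intros)
  ultimately have "null_frontier M (ball x r)"
    using measure_eq_0_subset[OF M] by (auto simp: null_frontier_def)
  with r that show thesis by blast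
qed

text \<open>Compactness gives a finite cover by balls of radius below \<open>e / 2\<close> with null
  frontier; the partition consists of the atoms of the algebra they generate. As the balls cover the
  space, each atom lies inside one of them.\<close>

lemma small_null_frontier_partition:
  fixes M :: "'a::metric_space measure"
  assumes cpt: "compact (UNIV :: 'a set)" and M: "M \<in> prob_measures" and e: "0 < e"
  obtains P where "P \<in> finite_partitions" "\<And>A. A \<in> P \<Longrightarrow> null_frontier M A"
    "\<And>A x y. A \<in> P \<Longrightarrow> x \<in> A \<Longrightarrow> y \<in> A \<Longrightarrow> dist x y < e"
proof -
  have "\<exists>r. 0 < r \<and> r < e / 2 \<and> null_frontier M (ball x r)" for x
    using null_frontier_ball[OF M, of "e / 2" x] e by auto
  then obtain r where r: "\<And>x. 0 < r x" "\<And>x. r x < e / 2" "\<And>x. null_frontier M (ball x (r x))"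
    by metis
  have "UNIV \<subseteq> (\<Union>x\<in>UNIV. ball x (r x))"
    using r(1) by (meson UN_I UNIV_I centre_in_ball subsetI)
  from compactE_image[OF cpt open_ball this] obtain T where
    T: "finite T" "UNIV \<subseteq> (\<Union>x\<in>T. ball x (r x))"
    by metis
  define U where "U t = ball t (r t)" for t
  \<comment> \<open>\<open>K x\<close> is the signature of \<open>x\<close>: the centres whose balls
    contain it. Cells are the classes of equal signature, hence nonempty and pairwise
    disjoint.\<close>
  define K where "K x = {t \<in> T. x \<in> U t}" for x
  define cell where "cell x = {y. K y = K x}" for x
  have cell_eq: "cell x = (\<Inter>t\<in>T. if x \<in> U t then U t else - U t)" for x
  proof (rule set_eqI)
    fix y
    have "y \<in> cell x \<longleftrightarrow> (\<forall>t\<in>T. y \<in> U t \<longleftrightarrow> x \<in> U t)"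
      unfolding cell_def K_def by blast
    also have "\<dots> \<longleftrightarrow> (\<forall>t\<in>T. y \<in> (if x \<in> U t then U t else - U t))"
      by (intro ball_cong) auto
    finally show "y \<in> cell x \<longleftrightarrow> y \<in> (\<Inter>t\<in>T. if x \<in> U t then U t else - U t)"
      by blast
  qed
  have cell_cong: "cell x = cell y" if "z \<in> cell x" "z \<in> cell y" for x y z
    using that unfolding cell_def by auto
  show thesis
  proof (rule that[of "range cell"])
    show nf: "null_frontier M A" if A: "A \<in> range cell" for A
    proof -
      have U: "null_frontier M (U t)" for t unfolding U_def by (rule r(3))
      obtain x where "A = cell x" using A by blast
      moreover have "null_frontier M (cell x)"
        unfolding cell_eq using T(1) U null_frontier_Compl[OF U]
        by (intro null_frontier_INT[OF M]) simp_all
      ultimately show ?thesis by simp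
    qed
    have "finite (range cell)"
    proof -
      have "range K \<subseteq> Pow T" by (auto simp: K_def)
      then have "finite (range K)" by (rule finite_subset) (simp add: T(1))
      moreover have "range cell = (\<lambda>k. {y. K y = k}) ` range K" by (auto simp: cell_def)
      ultimately show ?thesis by simp
    qed
    moreover have "partition_on UNIV (range cell)"
    proof (rule partition_onI)
      show "\<Union>(range cell) = UNIV" by (auto simp: cell_def)
      show "{} \<notin> range cell" by (auto simp: cell_def)
      fix p q assume "p \<in> range cell" "q \<in> range cell" "p \<noteq> q"
      then show "disjnt p q" using cell_cong unfolding disjnt_def by blast
    qed
    ultimately show "range cell \<in> finite_partitions"
      using nf by (auto simp: finite_partitions_def null_frontier_def)
    fix A x y assume "A \<in> range cell" "x \<in> A" "y \<in> A"
    then have "K x = K y" by (auto simp: cell_def)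
    moreover obtain t where "t \<in> K x" using T(2) unfolding K_def U_def by blast
    ultimately have "dist t x < r t" "dist t y < r t" by (auto simp: K_def U_def)
    then show "dist x y < e"
      using r(2)[of t] dist_triangle3[of x y t] by linarith
  qed
qed

subsection \<open>Counting orbits by block codes\<close>

text \<open>For each residue \<open>j\<close>, a point is encoded by its block label at time \<open>0\<close> and those at the times
  congruent to \<open>j\<close>; averaging over \<open>j\<close> makes every time count exactly once.\<close>

lemma card_le_block_code:
  fixes f :: "'a \<Rightarrow> 'a" and B :: "'a \<Rightarrow> 'b" and p :: "'b \<Rightarrow> real"
  assumes E: "finite E" and S: "finite S" and m: "m \<ge> 1" and B: "\<And>x. B x \<in> S"
    and p: "\<And>b. b \<in> S \<Longrightarrow> 0 < p b" "sum p S = 1"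
    and inj: "\<And>x y j. x \<in> E \<Longrightarrow> y \<in> E \<Longrightarrow> j < m \<Longrightarrow> B x = B y \<Longrightarrow>
      (\<And>i. i < n \<Longrightarrow> i mod m = j \<Longrightarrow> B ((f ^^ i) x) = B ((f ^^ i) y)) \<Longrightarrow> x = y"
    and c: "\<And>x. x \<in> E \<Longrightarrow> - c \<le> (\<Sum>i<n. ln (p (B ((f ^^ i) x))))"
  shows "real (card E) \<le> real m * real (card S) * exp (c / real m)"
proof -
  define I where "I j = {i. i < n \<and> i mod m = j}" for j
  \<comment> \<open>The product weight, under \<open>p\<close>, of the labels read at times
    congruent to \<open>j\<close>.\<close>
  define w where "w j x = (\<Prod>i\<in>I j. p (B ((f ^^ i) x)))" for j x
  have I: "finite (I j)" for j unfolding I_def by auto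
  have w_pos: "0 < w j x" for j x unfolding w_def by (intro prod_pos) (use p(1) B in auto)
  \<comment> \<open>Since the code is injective, the sum is at most the weight of all codes. Words
    on \<open>I j\<close> have total weight 1, and the unweighted label at time 0 accounts for the
    factor \<open>card S\<close>.\<close>
  have residue: "(\<Sum>x\<in>E. w j x) \<le> real (card S)" if j: "j < m" for j
  proof -
    define code where "code x = (B x, restrict (\<lambda>i. B ((f ^^ i) x)) (I j))" for x
    have "inj_on code E"
    proof (rule inj_onI)
      fix x y assume xy: "x \<in> E" "y \<in> E" "code x = code y"
      have "B x = B y" and r: "restrict (\<lambda>i. B ((f ^^ i) x)) (I j) = restrict (\<lambda>i. B ((f ^^ i) y)) (I j)"
        using xy(3) by (simp_all add: code_def)
      moreover have "B ((f ^^ i) x) = B ((f ^^ i) y)" if "i < n" "i mod m = j" for i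
        using fun_cong[OF r, of i] that by (simp add: I_def)
      ultimately show "x = y" by (intro inj[OF xy(1,2) j])
    qed
    then have "(\<Sum>x\<in>E. w j x) = (\<Sum>z\<in>code ` E. \<Prod>i\<in>I j. p (snd z i))"
      by (subst sum.reindex) (auto simp: w_def code_def)
    also have "\<dots> \<le> (\<Sum>z\<in>S \<times> (I j \<rightarrow>\<^sub>E S). \<Prod>i\<in>I j. p (snd z i))"
    proof (rule sum_mono2)
      show "finite (S \<times> (I j \<rightarrow>\<^sub>E S))" using S I by (intro finite_cartesian_product finite_PiE)
      show "code ` E \<subseteq> S \<times> (I j \<rightarrow>\<^sub>E S)" using B by (auto simp: code_def)
      fix z assume "z \<in> S \<times> (I j \<rightarrow>\<^sub>E S) - code ` E"
      then show "0 \<le> (\<Prod>i\<in>I j. p (snd z i))"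
        by (intro prod_nonneg) (auto dest!: PiE_mem intro!: less_imp_le[OF p(1)])
    qed
    also have "\<dots> = real (card S) * (\<Sum>g\<in>I j \<rightarrow>\<^sub>E S. \<Prod>i\<in>I j. p (g i))"
      using sum.cartesian_product[of "\<lambda>_ g. \<Prod>i\<in>I j. p (g i)" "I j \<rightarrow>\<^sub>E S" S]
      by (simp add: case_prod_unfold)
    also have "(\<Sum>g\<in>I j \<rightarrow>\<^sub>E S. \<Prod>i\<in>I j. p (g i)) = (\<Prod>i\<in>I j. \<Sum>b\<in>S. p b)"
      using prod_sum_PiE[of "I j" "\<lambda>_. S" "\<lambda>_. p"] I S by simp
    finally show ?thesis using p(2) by simp
  qed
  \<comment> \<open>The residue classes partition the times, so the logarithms of the
    \<open>m\<close> weights add up to at least \<open>- c\<close>, and one of them reaches the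
    average.\<close>
  have point: "exp (- c / real m) \<le> (\<Sum>j<m. w j x)" if x: "x \<in> E" for x
  proof -
    have "\<exists>j<m. - c / real m \<le> ln (w j x)"
    proof (rule ccontr)
      assume "\<not> ?thesis"
      then have "(\<Sum>j<m. ln (w j x)) < (\<Sum>j<m. - c / real m)"
        using m by (intro sum_strict_mono) (auto simp: not_le lessThan_empty_iff)
      also have "\<dots> = - c" using m by simp
      also have "(\<Sum>j<m. ln (w j x)) = (\<Sum>j<m. \<Sum>i\<in>I j. ln (p (B ((f ^^ i) x))))"
        unfolding w_def by (intro sum.cong refl ln_prod) (use I p(1)[OF B] in \<open>auto simp: less_imp_neq[symmetric]\<close>)
      also have "\<dots> = (\<Sum>i<n. ln (p (B ((f ^^ i) x))))"
        using sum.group[of "{..<n}" "{..<m}" "\<lambda>i. i mod m" "\<lambda>i. ln (p (B ((f ^^ i) x)))"] m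
        by (auto simp: I_def image_subset_iff)
      finally show False using c[OF x] by simp
    qed
    then obtain j where j: "j < m" "- c / real m \<le> ln (w j x)" by auto
    then have "exp (- c / real m) \<le> w j x"
      using w_pos[of j x] by (simp add: ln_ge_iff)
    also have "\<dots> \<le> (\<Sum>j<m. w j x)"
      using j(1) by (intro member_le_sum) (auto intro: less_imp_le[OF w_pos])
    finally show ?thesis .
  qed
  \<comment> \<open>The total weight is counted twice: from below point by point, from above residue
    by residue.\<close>
  have "real (card E) * exp (- c / real m) = (\<Sum>x\<in>E. exp (- c / real m))" by simp
  also have "\<dots> \<le> (\<Sum>x\<in>E. \<Sum>j<m. w j x)" by (intro sum_mono point)
  also have "\<dots> = (\<Sum>j<m. \<Sum>x\<in>E. w j x)" by (rule sum.swap)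
  also have "\<dots> \<le> (\<Sum>j<m. real (card S))" by (intro sum_mono residue) auto
  finally have "real (card E) * exp (- c / real m) * exp (c / real m) \<le> real m * real (card S) * exp (c / real m)"
    by (intro mult_right_mono) auto
  then show ?thesis
    by (simp add: mult.assoc flip: exp_add)
qed

subsection \<open>Empirical measures\<close>

lemma measure_empirical_measure_indicator:
  assumes "A \<in> sets borel"
  shows "measure (empirical_measure f n x) A = (\<Sum>k<n. indicator A ((f ^^ k) x)) / real n"
  using assms by (simp add: measure_empirical_measure measure_return)

lemma integral_empirical_measure:
  fixes g :: "'a::topological_space \<Rightarrow> real"
  assumes "g \<in> borel_measurable borel"
  shows "integral\<^sup>L (empirical_measure f n x) g = birkhoff_sum f g n x / real n"
proof -
  have "(\<lambda>k. (f ^^ k) x) \<in> uniform_count_measure {..<n} \<rightarrow>\<^sub>M borel"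
    by (auto simp: measurable_def space_uniform_count_measure sets_uniform_count_measure)
  then have "integral\<^sup>L (empirical_measure f n x) g = (\<integral>k. g ((f ^^ k) x) \<partial>uniform_count_measure {..<n})"
    unfolding empirical_measure_def using assms by (intro integral_distr)
  then show ?thesis
    by (simp add: integral_uniform_count_measure birkhoff_sum_def)
qed

lemma bowen_dist_greater:
  assumes "n \<ge> 1"
  shows "bowen_dist f n x y > e \<longleftrightarrow> (\<exists>i<n. dist ((f ^^ i) x) ((f ^^ i) y) > e)"
  unfolding bowen_dist_def using assms by (subst Max_gr_iff) (auto simp: lessThan_empty_iff)

lemma iterated_join_same_cell:
  assumes "C \<in> iterated_join f P m" "x \<in> C" "y \<in> C" "i < m"
  shows "\<exists>A\<in>P. (f ^^ i) x \<in> A \<and> (f ^^ i) y \<in> A"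
  using assms by (auto simp: iterated_join_def)

subsection \<open>The upper bound\<close>

lemma ereal_ln_ereal: "0 < r \<Longrightarrow> ereal_ln (ereal r) = ereal (ln r)"
  by (simp add: ereal_ln_def)

lemma ereal_ln_mono: "x \<le> y \<Longrightarrow> ereal_ln x \<le> ereal_ln y"
  by (cases x; cases y) (auto simp: ereal_ln_def zero_ereal_def)

text \<open>Mixing \<open>q\<close> with the uniform distribution makes every weight positive, also
  on null cells. Since p \<ge> q / (1 + \<eta>), the cross entropy exceeds the entropy by at most ln
  (1 + \<eta>) \<le> \<eta>.\<close>

lemma cross_entropy_le:
  fixes q :: "'b \<Rightarrow> real"
  assumes S: "finite S" "S \<noteq> {}" and q: "\<And>b. b \<in> S \<Longrightarrow> 0 \<le> q b" "sum q S = 1" and \<eta>: "0 < \<eta>"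
  defines "p \<equiv> \<lambda>b. (q b + \<eta> / real (card S)) / (1 + \<eta>)"
  shows "sum p S = 1" "\<And>b. b \<in> S \<Longrightarrow> 0 < p b"
    "- (\<Sum>b\<in>S. q b * ln (p b)) \<le> - (\<Sum>b\<in>S. q b * ln (q b)) + \<eta>"
proof -
  have cS: "real (card S) > 0" using S by (simp add: card_gt_0_iff)
  show "sum p S = 1"
    using q(2) \<eta> cS by (simp add: p_def sum.distrib flip: sum_divide_distrib)
  show pos: "\<And>b. b \<in> S \<Longrightarrow> 0 < p b"
    unfolding p_def using q(1) \<eta> cS by (simp add: add_nonneg_pos)
  have "q b * ln (q b) - \<eta> * q b \<le> q b * ln (p b)" if b: "b \<in> S" for b
  proof (cases "q b = 0")
    case False
    then have qb: "q b > 0" using q(1)[OF b] by simp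
    have "q b / (1 + \<eta>) \<le> p b"
      unfolding p_def using \<eta> cS by (intro divide_right_mono) auto
    then have "ln (q b / (1 + \<eta>)) \<le> ln (p b)"
      using qb \<eta> by (intro ln_mono) auto
    moreover have "ln (q b / (1 + \<eta>)) = ln (q b) - ln (1 + \<eta>)"
      using qb \<eta> by (simp add: ln_div)
    moreover have "ln (1 + \<eta>) \<le> \<eta>" using \<eta> by (intro ln_add_one_self_le_self) simp
    ultimately have "q b * (ln (q b) - \<eta>) \<le> q b * ln (p b)"
      using qb by (intro mult_left_mono) auto
    then show ?thesis by (simp add: algebra_simps)
  qed simp
  then have "(\<Sum>b\<in>S. q b * ln (q b) - \<eta> * q b) \<le> (\<Sum>b\<in>S. q b * ln (p b))"
    by (intro sum_mono)
  then show "- (\<Sum>b\<in>S. q b * ln (p b)) \<le> - (\<Sum>b\<in>S. q b * ln (q b)) + \<eta>"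
    using q(2) by (simp add: sum_subtractf flip: sum_distrib_left)
qed

lemma limsup_ereal_ln_le:
  assumes K: "0 < K" and b: "\<And>n. n \<ge> 1 \<Longrightarrow> s n \<le> ereal (K * exp (real n * c))"
  shows "limsup (\<lambda>n. ereal_ln (s n) / ereal (real n)) \<le> ereal c"
proof -
  have "ereal_ln (s n) / ereal (real n) \<le> ereal (ln K / real n + c)" if n: "n \<ge> 1" for n
  proof -
    have "ereal_ln (s n) \<le> ereal (ln (K * exp (real n * c)))"
      using ereal_ln_mono[OF b[OF n]] K by (simp add: ereal_ln_ereal)
    also have "ln (K * exp (real n * c)) = ln K + real n * c"
      using K by (simp add: ln_mult)
    also have "ereal (ln K + real n * c) = ereal (real n) * ereal (ln K / real n + c)"
      using n by (simp add: distrib_left)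
    finally show ?thesis
      using n by (subst ereal_divide_le_pos) auto
  qed
  then have "limsup (\<lambda>n. ereal_ln (s n) / ereal (real n)) \<le> limsup (\<lambda>n. ereal (ln K / real n + c))"
    by (intro Limsup_mono eventually_sequentiallyI[of 1])
  also have "(\<lambda>n. ereal (ln K / real n + c)) \<longlonglongrightarrow> ereal (0 + c)"
    by (intro tendsto_intros lim_const_over_n)
  then have "limsup (\<lambda>n. ereal (ln K / real n + c)) = ereal c"
    by (intro lim_imp_Limsup) auto
  finally show ?thesis .
qed

text \<open>On a suitable neighbourhood the sum is at most the number of points, controlled by block
  codes, times the largest weight, controlled by the integral of \<open>\<phi>\<close>. The three
  \<eta> are spent on smoothing the cell weights, on the deviation of cell frequencies and on the
  integral.\<close>

lemma exists_nbhd_limsup_sep_sum_le: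
  fixes f :: "'a::metric_space \<Rightarrow> 'a"
  assumes cpt: "compact (UNIV :: 'a set)" and f: "continuous_on UNIV f" and \<phi>: "continuous_on UNIV \<phi>"
    and M: "M \<in> invariant_measures f" and \<epsilon>: "0 < \<epsilon>" and h: "ks_entropy f M < ereal h" and \<eta>: "0 < \<eta>"
  shows "\<exists>F\<in>nbhds_of M. limsup (\<lambda>n. ereal_ln (sep_sum f F \<phi> n \<epsilon>) / ereal (real n))
    \<le> ereal (h + integral\<^sup>L M \<phi> + 3 * \<eta>)"
proof -
  note Mp = invariant_measuresD(1)[OF M]
  have fm: "f \<in> borel_measurable borel" by (rule borel_measurable_continuous_onI[OF f])
  obtain P where P: "P \<in> finite_partitions" "\<And>A. A \<in> P \<Longrightarrow> null_frontier M A"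
    "\<And>A x y. A \<in> P \<Longrightarrow> x \<in> A \<Longrightarrow> y \<in> A \<Longrightarrow> dist x y < \<epsilon>"
    by (rule small_null_frontier_partition[OF cpt Mp \<epsilon>]) metis
  obtain m where m: "m \<ge> 1" "partition_entropy M (iterated_join f P m) / real m < h"
    using partition_entropy_rate_le_ks_entropy[OF fm M P(1) h] by auto
  define S where "S = iterated_join f P m"
  note S = iterated_join_partition[OF fm P(1), of m, folded S_def]
  have Sne: "S \<noteq> {}" using S(3) by auto
  define Bl where "Bl x = (THE b. b \<in> S \<and> x \<in> b)" for x
  have Bl_eq: "Bl x = b" if "b \<in> S" "x \<in> b" for x b
    unfolding Bl_def
  proof (rule the_equality)
    show "b' = b" if "b' \<in> S \<and> x \<in> b'" for b'
      using disjointD[OF S(2), of b b'] that \<open>b \<in> S\<close> \<open>x \<in> b\<close> by blast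
  qed (use that in simp)
  have Bl: "Bl x \<in> S" "x \<in> Bl x" for x
  proof -
    obtain b where "b \<in> S" "x \<in> b" using S(3) by blast
    then show "Bl x \<in> S" "x \<in> Bl x" using Bl_eq by auto
  qed
  \<comment> \<open>Smoothed weights: an empirical measure close to \<open>M\<close> may still
    charge cells that are null for \<open>M\<close>.\<close>
  define p where "p = (\<lambda>b. (measure M b + \<eta> / real (card S)) / (1 + \<eta>))"
  have p: "sum p S = 1" "\<And>b. b \<in> S \<Longrightarrow> 0 < p b"
    "- (\<Sum>b\<in>S. measure M b * ln (p b)) \<le> partition_entropy M S + \<eta>"
    using cross_entropy_le[OF S(1) Sne measure_nonneg measure_sum_partition[OF Mp S] \<eta>]
    unfolding p_def partition_entropy_def by blast+
  \<comment> \<open>This makes \<open>ln (p b)\<close> nonpositive, so upper bounds on the cell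
    frequencies bound the sum of logarithms from below; the neighbourhood \<open>F\<close> can then
    be one-sided.\<close>
  have p_le_1: "p b \<le> 1" if "b \<in> S" for b
    using member_le_sum[OF that, of p] p S(1) by (metis DiffD1 less_imp_le)
  define D where "D = (\<Sum>b\<in>S. - ln (p b))"
  have D: "0 \<le> D" unfolding D_def
    by (intro sum_nonneg) (use p(2) p_le_1 in auto)
  \<comment> \<open>Excess frequencies up to \<open>\<rho>\<close> in every cell cost at most
    \<open>\<rho> * D\<close> in the logarithms. The denominator \<open>D + 1\<close> stays positive
    even if \<open>D = 0\<close>.\<close>
  define \<rho> where "\<rho> = \<eta> / (D + 1)"
  have \<rho>: "0 < \<rho>" "\<rho> * D \<le> \<eta>"
  proof -
    show "0 < \<rho>" using D \<eta> by (simp add: \<rho>_def)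
    then have "\<rho> * D \<le> \<rho> * (D + 1)" by (intro mult_left_mono) auto
    then show "\<rho> * D \<le> \<eta>" using D by (simp add: \<rho>_def)
  qed
  have \<phi>_bdd: "bounded (range \<phi>)"
    using compact_continuous_image[OF \<phi> cpt] by (rule compact_imp_bounded)
  define F where "F = {N \<in> prob_measures. \<forall>b\<in>S. measure N b < measure M b + \<rho>} \<inter>
    {N \<in> prob_measures. integral\<^sup>L N \<phi> < integral\<^sup>L M \<phi> + \<eta>}"
  have "F \<in> nbhds_of M"
    unfolding F_def
  proof (intro nbhds_of_Int nbhds_of_finite_ball nbhds_of_measure_less nbhds_of_integral_less)
    \<comment> \<open>Here the null frontiers enter: the closure of a cell has the same mass as the
      cell, so the frequency condition defines a neighbourhood.\<close>
    fix b assume b: "b \<in> S"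
    have "null_frontier M b"
      using null_frontier_iterated_join[OF M f P(2)] b by (simp add: S_def)
    then show "measure M (closure b) < measure M b + \<rho>"
      using null_frontier_measure_closure[OF Mp] \<rho> by simp
  qed (use S Mp \<phi> \<phi>_bdd \<eta> in auto)
  moreover have "sep_sum f F \<phi> n \<epsilon> \<le>
      ereal (real m * real (card S) * exp (real n * (h + integral\<^sup>L M \<phi> + 3 * \<eta>)))" if n: "n \<ge> 1" for n
    unfolding sep_sum_def
  proof (rule SUP_least, clarify)
    fix E assume E: "finite E" "E \<subseteq> emp_set f n F" "separated f n \<epsilon> E"
    define c where "c = real n * (partition_entropy M S + 2 * \<eta>)"
    have card: "real (card E) \<le> real m * real (card S) * exp (c / real m)"
    proof (rule card_le_block_code[where f = f and B = Bl and p = p and n = n])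
      fix x y j assume xy: "x \<in> E" "y \<in> E" and j: "j < m" and B0: "Bl x = Bl y"
        and Bj: "\<And>i. i < n \<Longrightarrow> i mod m = j \<Longrightarrow> Bl ((f ^^ i) x) = Bl ((f ^^ i) y)"
      \<comment> \<open>Equal labels at time \<open>i\<close> keep the two orbits within \<epsilon>
        during \<open>m\<close> steps.\<close>
      have close: "dist ((f ^^ k) ((f ^^ i) x)) ((f ^^ k) ((f ^^ i) y)) < \<epsilon>"
        if "Bl ((f ^^ i) x) = Bl ((f ^^ i) y)" "k < m" for i k
        using iterated_join_same_cell[of "Bl ((f ^^ i) x)" f P m "(f ^^ i) x" "(f ^^ i) y" k]
          Bl[of "(f ^^ i) x"] Bl[of "(f ^^ i) y"] that P(3) by (auto simp: S_def)
      have "dist ((f ^^ i) x) ((f ^^ i) y) < \<epsilon>" if i: "i < n" for i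
      \<comment> \<open>Times before \<open>j\<close> are covered by the block starting at time 0,
        because \<open>j < m\<close>.\<close>
      proof (cases "i < j")
        case True
        then show ?thesis using close[of 0 i] B0 j by simp
      next
        case False
        \<comment> \<open>\<open>i - k\<close> is the last time up to \<open>i\<close> that is
          congruent to \<open>j\<close>; the block starting there covers time
          \<open>i\<close>.\<close>
        define k where "k = (i - j) mod m"
        have k: "k < m" "k \<le> i - j" using m(1) by (auto simp: k_def)
        have "i - k = j + m * ((i - j) div m)"
          using False mult_div_mod_eq[of m "i - j"] unfolding k_def by linarith
        then have "(i - k) mod m = j" using j by simp
        then have "Bl ((f ^^ (i - k)) x) = Bl ((f ^^ (i - k)) y)" using Bj[of "i - k"] i by simp
        from close[OF this k(1)] show ?thesis
          using k funpow_add[of k "i - k" f] by (simp add: fun_eq_iff)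
      qed
      then show "x = y"
        using E(3) xy n unfolding separated_def pairwise_def bowen_dist_greater[OF n] by force
    next
      fix x assume "x \<in> E"
      then have xF: "empirical_measure f n x \<in> F" using E(2) by (auto simp: emp_set_def)
      \<comment> \<open>Sorting the times by visited cell turns the sum into \<open>n\<close> times
        the integral of the log-weights against the empirical measure.\<close>
      have "(\<Sum>i<n. ln (p (Bl ((f ^^ i) x)))) = (\<Sum>i<n. \<Sum>b\<in>S. indicator b ((f ^^ i) x) * ln (p b))"
      proof (intro sum.cong refl)
        fix i
        let ?y = "(f ^^ i) x"
        have "(\<Sum>b\<in>S. indicator b ?y * ln (p b)) = (\<Sum>b\<in>S. if b = Bl ?y then ln (p b) else 0)"
        proof (intro sum.cong refl)
          fix b assume b: "b \<in> S"
          have "?y \<in> b \<longleftrightarrow> b = Bl ?y" using Bl_eq[OF b] Bl(2)[of ?y] by metis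
          then show "indicator b ?y * ln (p b) = (if b = Bl ?y then ln (p b) else 0)"
            by (simp add: indicator_def)
        qed
        then show "ln (p (Bl ?y)) = (\<Sum>b\<in>S. indicator b ?y * ln (p b))"
          using S(1) Bl(1)[of ?y] by simp
      qed
      also have "\<dots> = (\<Sum>b\<in>S. (\<Sum>i<n. indicator b ((f ^^ i) x)) * ln (p b))"
        by (subst sum.swap) (simp add: sum_distrib_right)
      also have "\<dots> = (\<Sum>b\<in>S. real n * (measure (empirical_measure f n x) b * ln (p b)))"
        using S(4) n by (intro sum.cong refl) (auto simp: measure_empirical_measure_indicator)
      also have "\<dots> \<ge> (\<Sum>b\<in>S. real n * ((measure M b + \<rho>) * ln (p b)))"
        using xF p(2) p_le_1
        by (intro sum_mono mult_left_mono mult_right_mono_neg) (auto simp: F_def intro!: less_imp_le)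
      also (xtrans) have "(\<Sum>b\<in>S. real n * ((measure M b + \<rho>) * ln (p b))) =
          real n * ((\<Sum>b\<in>S. measure M b * ln (p b)) - \<rho> * D)"
        by (simp add: D_def sum_negf distrib_right sum.distrib flip: sum_distrib_left)
      also (xtrans) have "- c \<le> real n * ((\<Sum>b\<in>S. measure M b * ln (p b)) - \<rho> * D)"
      proof -
        have "- (partition_entropy M S + 2 * \<eta>) \<le> (\<Sum>b\<in>S. measure M b * ln (p b)) - \<rho> * D"
          using p(3) \<rho>(2) by linarith
        from mult_left_mono[OF this, of "real n"] show ?thesis
          unfolding c_def by (simp only: mult_minus_right)
      qed
      finally show "- c \<le> (\<Sum>i<n. ln (p (Bl ((f ^^ i) x))))" .
    qed (use E S m p Bl in auto)
    \<comment> \<open>The choice of \<open>m\<close> bounds the entropy rate by \<open>h\<close>,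
      and dividing the error 2 \<eta> by \<open>m\<close> does not enlarge it.\<close>
    have "c / real m \<le> real n * (h + 2 * \<eta>)"
    proof -
      have "(partition_entropy M S + 2 * \<eta>) / real m \<le> h + 2 * \<eta>"
      proof -
        have "2 * \<eta> / real m \<le> 2 * \<eta>" using m(1) \<eta> by (simp add: divide_le_eq)
        then show ?thesis using m(2) by (simp add: S_def add_divide_distrib)
      qed
      from mult_left_mono[OF this, of "real n"] show ?thesis by (simp add: c_def)
    qed
    then have card': "real (card E) \<le> real m * real (card S) * exp (real n * (h + 2 * \<eta>))"
      by (intro order_trans[OF card] mult_left_mono) auto
    have "birkhoff_sum f \<phi> n x \<le> real n * (integral\<^sup>L M \<phi> + \<eta>)" if "x \<in> E" for x
    proof -
      have "integral\<^sup>L (empirical_measure f n x) \<phi> \<le> integral\<^sup>L M \<phi> + \<eta>"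
        using E(2) that by (auto simp: emp_set_def F_def)
      then show ?thesis
        using n borel_measurable_continuous_onI[OF \<phi>]
        by (simp add: integral_empirical_measure divide_le_eq mult.commute)
    qed
    then have "(\<Sum>x\<in>E. exp (birkhoff_sum f \<phi> n x)) \<le> real (card E) * exp (real n * (integral\<^sup>L M \<phi> + \<eta>))"
      by (intro sum_bounded_above) auto
    also have "\<dots> \<le> real m * real (card S) * exp (real n * (h + 2 * \<eta>)) * exp (real n * (integral\<^sup>L M \<phi> + \<eta>))"
      by (intro mult_right_mono card') auto
    also have "\<dots> = real m * real (card S) * exp (real n * (h + integral\<^sup>L M \<phi> + 3 * \<eta>))"
      by (simp add: algebra_simps flip: exp_add)
    finally show "ereal (\<Sum>x\<in>E. exp (birkhoff_sum f \<phi> n x)) \<le>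
        ereal (real m * real (card S) * exp (real n * (h + integral\<^sup>L M \<phi> + 3 * \<eta>)))"
      by simp
  qed
  then have "limsup (\<lambda>n. ereal_ln (sep_sum f F \<phi> n \<epsilon>) / ereal (real n)) \<le>
      ereal (h + integral\<^sup>L M \<phi> + 3 * \<eta>)"
    using m(1) S(1) Sne by (intro limsup_ereal_ln_le[where K = "real m * real (card S)"])
      (simp_all add: card_gt_0_iff)
  ultimately show ?thesis by blast
qed

text \<open>It suffices to reach every \<open>z\<close> above the right-hand side. The real number
  \<open>r\<close> squeezed in below \<open>z\<close> keeps the entropy below infinity and leaves
  room for a real \<open>h\<close> above it.\<close>

lemma INF_limsup_sep_sum_le:
  fixes f :: "'a::metric_space \<Rightarrow> 'a"
  assumes cpt: "compact (UNIV :: 'a set)" and f: "continuous_on UNIV f" and \<phi>: "continuous_on UNIV \<phi>"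
    and M: "M \<in> invariant_measures f" and \<epsilon>: "0 < \<epsilon>"
  shows "(INF F\<in>nbhds_of M. limsup (\<lambda>n. ereal_ln (sep_sum f F \<phi> n \<epsilon>) / ereal (real n)))
    \<le> ks_entropy f M + ereal (integral\<^sup>L M \<phi>)"
proof (rule dense_ge)
  fix z assume z: "ks_entropy f M + ereal (integral\<^sup>L M \<phi>) < z"
  obtain r where r: "ks_entropy f M + ereal (integral\<^sup>L M \<phi>) < ereal r" "ereal r < z"
    using ereal_dense2[OF z] by auto
  then have "ks_entropy f M < ereal (r - integral\<^sup>L M \<phi>)"
    by (cases "ks_entropy f M") auto
  then obtain h where h: "ks_entropy f M < ereal h" "h < r - integral\<^sup>L M \<phi>"
    using ereal_dense2 by force
  \<comment> \<open>A third of the remaining slack, so that the bound with three \<eta> becomes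
    exactly \<open>r\<close>.\<close>
  define \<eta> where "\<eta> = (r - integral\<^sup>L M \<phi> - h) / 3"
  have \<eta>: "0 < \<eta>" "h + integral\<^sup>L M \<phi> + 3 * \<eta> = r" using h(2) by (auto simp: \<eta>_def field_simps)
  obtain F where "F \<in> nbhds_of M"
    "limsup (\<lambda>n. ereal_ln (sep_sum f F \<phi> n \<epsilon>) / ereal (real n)) \<le> ereal r"
    using exists_nbhd_limsup_sep_sum_le[OF cpt f \<phi> M \<epsilon> h(1) \<eta>(1)] \<eta>(2) by auto
  then show "(INF F\<in>nbhds_of M. limsup (\<lambda>n. ereal_ln (sep_sum f F \<phi> n \<epsilon>) / ereal (real n))) \<le> z"
    using r(2) by (intro INF_lower2) auto
qed

subsection \<open>The lower bound\<close>

lemma delta_separated_mono: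
  assumes "delta_separated f \<delta> n \<epsilon> A" "\<delta>' \<le> \<delta>" "\<epsilon>' \<le> \<epsilon>"
  shows "delta_separated f \<delta>' n \<epsilon>' A"
proof -
  have "\<delta>' * real n \<le> real (card {j. j < n \<and> \<epsilon>' < dist ((f ^^ j) x) ((f ^^ j) y)})"
    if "\<delta> * real n \<le> real (card {j. j < n \<and> \<epsilon> < dist ((f ^^ j) x) ((f ^^ j) y)})" for x y
  proof -
    have "\<delta>' * real n \<le> \<delta> * real n" using assms(2) by (intro mult_right_mono) auto
    moreover have "card {j. j < n \<and> \<epsilon> < dist ((f ^^ j) x) ((f ^^ j) y)} \<le>
        card {j. j < n \<and> \<epsilon>' < dist ((f ^^ j) x) ((f ^^ j) y)}"
      using assms(3) by (intro card_mono) auto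
    ultimately show ?thesis using that by linarith
  qed
  then show ?thesis
    using assms(1) unfolding delta_separated_def pairwise_def by blast
qed

lemma delta_separated_imp_separated:
  assumes "delta_separated f \<delta> n \<epsilon> A" "0 < \<delta>" "1 \<le> n"
  shows "separated f n \<epsilon> A"
  unfolding separated_def
proof (rule pairwiseI)
  fix x y assume "x \<in> A" "y \<in> A" "x \<noteq> y"
  then have "\<delta> * real n \<le> real (card {j. j < n \<and> \<epsilon> < dist ((f ^^ j) x) ((f ^^ j) y)})"
    using assms(1) unfolding delta_separated_def pairwise_def by blast
  moreover have "0 < \<delta> * real n" using assms by simp
  ultimately have "card {j. j < n \<and> \<epsilon> < dist ((f ^^ j) x) ((f ^^ j) y)} \<noteq> 0"
    by linarith
  then have "{j. j < n \<and> \<epsilon> < dist ((f ^^ j) x) ((f ^^ j) y)} \<noteq> {}" by force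
  then show "\<epsilon> < bowen_dist f n x y"
    unfolding bowen_dist_greater[OF assms(3)] by blast
qed

lemma delta_sep_sum_mono:
  assumes "\<delta>' \<le> \<delta>" "\<epsilon>' \<le> \<epsilon>"
  shows "delta_sep_sum f F \<phi> \<delta> n \<epsilon> \<le> delta_sep_sum f F \<phi> \<delta>' n \<epsilon>'"
  unfolding delta_sep_sum_def using delta_separated_mono[OF _ assms] by (intro SUP_subset_mono) auto

lemma delta_sep_sum_le_sep_sum:
  assumes "0 < \<delta>" "1 \<le> n"
  shows "delta_sep_sum f F \<phi> \<delta> n \<epsilon> \<le> sep_sum f F \<phi> n \<epsilon>"
  unfolding delta_sep_sum_def sep_sum_def
  using delta_separated_imp_separated[OF _ assms] by (intro SUP_subset_mono) auto

text \<open>The Birkhoff sum is \<open>n\<close> times the integral against the empirical measure,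
  so each orbit counted in \<open>G\<close> has weight at least \<open>exp (n a)\<close>.\<close>

lemma max_separated_le_delta_sep_sum:
  fixes f :: "'a::metric_space \<Rightarrow> 'a"
  assumes G: "G \<subseteq> F" "\<And>N. N \<in> G \<Longrightarrow> a \<le> integral\<^sup>L N \<phi>"
    and \<phi>: "\<phi> \<in> borel_measurable borel" and n: "1 \<le> n"
  shows "max_separated f G \<delta> n \<epsilon> \<le> ereal (exp (- (real n * a))) * delta_sep_sum f F \<phi> \<delta> n \<epsilon>"
  unfolding max_separated_def
proof (rule SUP_least, clarify)
  fix A assume A: "finite A" "A \<subseteq> emp_set f n G" "delta_separated f \<delta> n \<epsilon> A"
  have "real n * a \<le> birkhoff_sum f \<phi> n x" if "x \<in> A" for x
  proof -
    have "a \<le> integral\<^sup>L (empirical_measure f n x) \<phi>"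
      using A(2) that G(2) by (auto simp: emp_set_def)
    then show ?thesis
      using n \<phi> by (simp add: integral_empirical_measure le_divide_eq mult.commute)
  qed
  then have "real (card A) * exp (real n * a) \<le> (\<Sum>x\<in>A. exp (birkhoff_sum f \<phi> n x))"
    by (intro sum_bounded_below) auto
  then have "real (card A) \<le> exp (- (real n * a)) * (\<Sum>x\<in>A. exp (birkhoff_sum f \<phi> n x))"
    by (simp add: exp_minus field_simps)
  then have "ereal (real (card A)) \<le> ereal (exp (- (real n * a))) * ereal (\<Sum>x\<in>A. exp (birkhoff_sum f \<phi> n x))"
    by simp
  also have "\<dots> \<le> ereal (exp (- (real n * a))) * delta_sep_sum f F \<phi> \<delta> n \<epsilon>"
    unfolding delta_sep_sum_def using A G(1)
    by (intro ereal_mult_left_mono SUP_upper) (auto simp: emp_set_def)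
  finally show "ereal (real (card A)) \<le> ereal (exp (- (real n * a))) * delta_sep_sum f F \<phi> \<delta> n \<epsilon>" .
qed

lemma ereal_exp_mono: "x \<le> y \<Longrightarrow> ereal_exp x \<le> ereal_exp y"
  by (cases x; cases y) (auto simp: ereal_exp_def)

text \<open>The approximating ergodic measure depends on \<open>F\<close>, but uniform separation
  supplies \<delta> and \<epsilon> from \<eta> alone. Hence the thresholds are fixed before the
  infimum over neighbourhoods is taken.\<close>

lemma le_INF_liminf_delta_sep_sum:
  fixes f :: "'a::metric_space \<Rightarrow> 'a"
  assumes cpt: "compact (UNIV :: 'a set)" and sep: "uniform_separation f" and dense: "entropy_dense f"
    and \<phi>: "continuous_on UNIV \<phi>" and M: "M \<in> invariant_measures f"
    and r: "r < ks_entropy f M + ereal (integral\<^sup>L M \<phi>)"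
  shows "\<exists>\<delta>0>0. \<exists>\<epsilon>0>0. \<forall>\<delta> \<epsilon>. \<delta> \<le> \<delta>0 \<longrightarrow> \<epsilon> \<le> \<epsilon>0 \<longrightarrow>
    r \<le> (INF F\<in>nbhds_of M. liminf (\<lambda>n. ereal_ln (delta_sep_sum f F \<phi> \<delta> n \<epsilon>) / ereal (real n)))"
proof -
  obtain s where s: "r < ereal s" "ereal s < ks_entropy f M + ereal (integral\<^sup>L M \<phi>)"
    using ereal_dense2[OF r] by auto
  then have "ereal (s - integral\<^sup>L M \<phi>) < ks_entropy f M"
    by (cases "ks_entropy f M") auto
  then obtain h where h: "s - integral\<^sup>L M \<phi> < h" "ereal h < ks_entropy f M"
    using ereal_dense2 by force
  \<comment> \<open>Half of the slack: one \<eta> is lost in the separation property, the other in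
    the integral of \<open>\<phi>\<close>.\<close>
  define \<eta> where "\<eta> = (h + integral\<^sup>L M \<phi> - s) / 2"
  have \<eta>: "0 < \<eta>" "h - \<eta> + (integral\<^sup>L M \<phi> - \<eta>) = s" using h(1) by (auto simp: \<eta>_def)
  obtain \<delta>0 \<epsilon>0 where \<delta>0: "\<delta>0 > 0" and \<epsilon>0: "\<epsilon>0 > 0"
    and sep': "\<forall>\<mu>\<in>ergodic_measures f. \<forall>F\<in>nbhds_of \<mu>. \<exists>n0. \<forall>n\<ge>n0.
        max_separated f F \<delta>0 n \<epsilon>0 \<ge> ereal_exp (ereal (real n) * (ks_entropy f \<mu> - ereal \<eta>))"
    using sep \<eta>(1) unfolding uniform_separation_def by blast
  have \<phi>_bdd: "bounded (range \<phi>)"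
    using compact_continuous_image[OF \<phi> cpt] by (rule compact_imp_bounded)
  have "ereal s \<le> liminf (\<lambda>n. ereal_ln (delta_sep_sum f F \<phi> \<delta> n \<epsilon>) / ereal (real n))"
    if le: "\<delta> \<le> \<delta>0" "\<epsilon> \<le> \<epsilon>0" and F: "F \<in> nbhds_of M" for \<delta> \<epsilon> F
  proof -
    obtain U where U: "openin weak_star U" "M \<in> U" "U \<subseteq> F" "F \<subseteq> prob_measures"
      using F unfolding nbhds_of_def by auto
    \<comment> \<open>\<open>G\<close> is open, hence a neighbourhood of each of its points; this
      serves first for \<open>M\<close> and then for the ergodic measure found inside it.\<close>
    define G where "G = U \<inter> {N \<in> prob_measures. integral\<^sup>L N \<phi> \<in> {integral\<^sup>L M \<phi> - \<eta><..}}"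
    have "openin weak_star G"
      unfolding G_def by (intro openin_Int U(1) openin_weak_star_integral[OF \<phi> \<phi>_bdd] open_greaterThan)
    then have G: "G \<in> nbhds_of N" if "N \<in> G" for N
      using that unfolding nbhds_of_def by (auto simp: G_def)
    have "M \<in> G" using U(2) invariant_measuresD(1)[OF M] \<eta>(1) by (auto simp: G_def)
    then obtain \<nu> where \<nu>: "\<nu> \<in> ergodic_measures f" "\<nu> \<in> G" "ereal h < ks_entropy f \<nu>"
      using dense M G[of M] h(2) unfolding entropy_dense_def by blast
    obtain n0 where n0: "\<And>n. n \<ge> n0 \<Longrightarrow>
        ereal_exp (ereal (real n) * (ks_entropy f \<nu> - ereal \<eta>)) \<le> max_separated f G \<delta>0 n \<epsilon>0"
      using sep' \<nu>(1) G[OF \<nu>(2)] by blast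
    have "ereal s \<le> ereal_ln (delta_sep_sum f F \<phi> \<delta> n \<epsilon>) / ereal (real n)" if n: "n \<ge> max n0 1" for n
    proof -
      let ?a = "integral\<^sup>L M \<phi> - \<eta>"
      let ?D = "delta_sep_sum f F \<phi> \<delta> n \<epsilon>"
      have "ereal (exp (real n * (h - \<eta>))) = ereal_exp (ereal (real n) * (ereal h - ereal \<eta>))"
        by (simp add: ereal_exp_def)
      also have "\<dots> \<le> ereal_exp (ereal (real n) * (ks_entropy f \<nu> - ereal \<eta>))"
        using \<nu>(3) by (intro ereal_exp_mono ereal_mult_left_mono ereal_minus_mono) auto
      also have "\<dots> \<le> max_separated f G \<delta>0 n \<epsilon>0" using n0 n by simp
      also have "\<dots> \<le> ereal (exp (- (real n * ?a))) * delta_sep_sum f F \<phi> \<delta>0 n \<epsilon>0"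
        using n U(3) borel_measurable_continuous_onI[OF \<phi>]
        by (intro max_separated_le_delta_sep_sum) (auto simp: G_def)
      also have "\<dots> \<le> ereal (exp (- (real n * ?a))) * ?D"
        using le by (intro ereal_mult_left_mono delta_sep_sum_mono) auto
      \<comment> \<open>Multiplying by the inverse exponential isolates the pressure sum without
        dividing extended reals.\<close>
      finally have "ereal (exp (real n * ?a)) * ereal (exp (real n * (h - \<eta>))) \<le>
          ereal (exp (real n * ?a)) * (ereal (exp (- (real n * ?a))) * ?D)"
        by (intro ereal_mult_left_mono) auto
      also have "\<dots> = ?D"
        by (simp add: exp_minus one_ereal_def[symmetric] flip: mult.assoc)
      also have "ereal (exp (real n * ?a)) * ereal (exp (real n * (h - \<eta>))) = ereal (exp (real n * s))"
        unfolding \<eta>(2)[symmetric] by (simp add: algebra_simps flip: exp_add)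
      finally have "ereal (real n * s) \<le> ereal_ln ?D"
        using ereal_ln_mono[of "ereal (exp (real n * s))" ?D] by (simp add: ereal_ln_ereal)
      then show ?thesis using n by (subst ereal_le_divide_pos) auto
    qed
    then show ?thesis
      by (intro Liminf_bounded eventually_sequentiallyI[of "max n0 1"])
  qed
  then have "r \<le> (INF F\<in>nbhds_of M. liminf (\<lambda>n. ereal_ln (delta_sep_sum f F \<phi> \<delta> n \<epsilon>) / ereal (real n)))"
    if "\<delta> \<le> \<delta>0" "\<epsilon> \<le> \<epsilon>0" for \<delta> \<epsilon>
    using that s(1) by (intro INF_greatest) (meson less_imp_le order_trans)
  then show ?thesis using \<delta>0 \<epsilon>0 by blast
qed

subsection \<open>Passing to the limits\<close>

text \<open>Used for the inner limit in \<delta>, which has to be identified for every fixed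
  \<epsilon>, although its value is estimated from below only for small \<epsilon>.\<close>

lemma antimono_tendsto_at_right_0:
  fixes g :: "real \<Rightarrow> ereal"
  assumes "\<And>x y. 0 < x \<Longrightarrow> x \<le> y \<Longrightarrow> g y \<le> g x"
  shows "(g \<longlongrightarrow> (SUP x\<in>{0<..}. g x)) (at_right 0)"
proof (rule increasing_tendsto)
  show "\<forall>\<^sub>F x in at_right 0. g x \<le> (SUP x\<in>{0<..}. g x)"
    by (auto simp: eventually_at_right_field intro!: exI[of _ 1] SUP_upper)
  fix a assume "a < (SUP x\<in>{0<..}. g x)"
  then obtain y where y: "0 < y" "a < g y" by (auto simp: less_SUP_iff)
  have "a < g x" if "0 < x" "x < y" for x
    using assms[of x y] that y by (simp add: order.strict_trans2)
  then show "\<forall>\<^sub>F x in at_right 0. a < g x"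
    using y(1) by (auto simp: eventually_at_right_field)
qed

lemma Lim_at_right_0_eqI:
  fixes g :: "real \<Rightarrow> ereal"
  assumes le: "\<And>x. 0 < x \<Longrightarrow> g x \<le> L"
    and ge: "\<And>r. r < L \<Longrightarrow> \<exists>x0>0. \<forall>x. 0 < x \<longrightarrow> x \<le> x0 \<longrightarrow> r \<le> g x"
  shows "Lim (at_right 0) g = L"
proof (rule tendsto_Lim)
  show "(g \<longlongrightarrow> L) (at_right 0)"
  proof (rule increasing_tendsto)
    show "\<forall>\<^sub>F x in at_right 0. g x \<le> L"
      using le by (auto simp: eventually_at_right_field intro!: exI[of _ 1])
    fix a assume "a < L"
    then obtain r where r: "a < r" "r < L" using dense by blast
    obtain x0 where "x0 > 0" "\<forall>x. 0 < x \<longrightarrow> x \<le> x0 \<longrightarrow> r \<le> g x" using ge[OF r(2)] by blast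
    then show "\<forall>\<^sub>F x in at_right 0. a < g x"
      using r(1) by (auto simp: eventually_at_right_field intro!: exI[of _ x0] order.strict_trans2[of a r])
  qed
qed simp

text \<open>The inner limit is the supremum over positive second arguments. It therefore inherits
  the bound \<open>L\<close> and, for small \<epsilon>, dominates the value at the single point
  \<open>x0\<close>.\<close>

lemma Lim_Lim_at_right_0_eqI:
  fixes g :: "real \<Rightarrow> real \<Rightarrow> ereal"
  assumes anti: "\<And>\<epsilon> x y. 0 < x \<Longrightarrow> x \<le> y \<Longrightarrow> g \<epsilon> y \<le> g \<epsilon> x"
    and le: "\<And>\<epsilon> x. 0 < \<epsilon> \<Longrightarrow> 0 < x \<Longrightarrow> g \<epsilon> x \<le> L"
    and ge: "\<And>r. r < L \<Longrightarrow> \<exists>x0>0. \<exists>\<epsilon>0>0. \<forall>x \<epsilon>. x \<le> x0 \<longrightarrow> \<epsilon> \<le> \<epsilon>0 \<longrightarrow> r \<le> g \<epsilon> x"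
  shows "Lim (at_right 0) (\<lambda>\<epsilon>. Lim (at_right 0) (g \<epsilon>)) = L"
proof (rule Lim_at_right_0_eqI)
  have inner: "Lim (at_right 0) (g \<epsilon>) = (SUP x\<in>{0<..}. g \<epsilon> x)" for \<epsilon>
    by (intro tendsto_Lim antimono_tendsto_at_right_0 anti) auto
  show "Lim (at_right 0) (g \<epsilon>) \<le> L" if "0 < \<epsilon>" for \<epsilon>
    unfolding inner using le[OF that] by (intro SUP_least) auto
  fix r assume "r < L"
  then obtain x0 \<epsilon>0 where *: "x0 > 0" "\<epsilon>0 > 0" "\<And>x \<epsilon>. x \<le> x0 \<Longrightarrow> \<epsilon> \<le> \<epsilon>0 \<Longrightarrow> r \<le> g \<epsilon> x"
    using ge by blast
  then have "r \<le> Lim (at_right 0) (g \<epsilon>)" if "\<epsilon> \<le> \<epsilon>0" for \<epsilon>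
    unfolding inner using that by (intro SUP_upper2[of x0]) auto
  then show "\<exists>\<epsilon>0>0. \<forall>\<epsilon>. 0 < \<epsilon> \<longrightarrow> \<epsilon> \<le> \<epsilon>0 \<longrightarrow> r \<le> Lim (at_right 0) (g \<epsilon>)"
    using *(2) by blast
qed

theorem theorem4p3:
  fixes f :: "'a::metric_space \<Rightarrow> 'a" and \<phi> :: "'a \<Rightarrow> real" and \<mu> :: "'a measure"
  assumes "compact (UNIV :: 'a set)"
    and "continuous_on UNIV f"
    and "uniform_separation f"
    and "entropy_dense f"
    and "continuous_on UNIV \<phi>"
    and "\<mu> \<in> invariant_measures f"
  shows "SP_lower f \<phi> \<mu> = SP_upper f \<phi> \<mu> \<and>
    SP'_lower f \<phi> \<mu> = SP'_upper f \<phi> \<mu> \<and>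
    SP_upper f \<phi> \<mu> = SP'_upper f \<phi> \<mu> \<and>
    SP'_upper f \<phi> \<mu> = ks_entropy f \<mu> + ereal (integral\<^sup>L \<mu> \<phi>)"
proof -
  define L where "L = ks_entropy f \<mu> + ereal (integral\<^sup>L \<mu> \<phi>)"
  define q where "q F n \<epsilon> = ereal_ln (sep_sum f F \<phi> n \<epsilon>) / ereal (real n)" for F n \<epsilon>
  define q' where "q' F \<delta> n \<epsilon> = ereal_ln (delta_sep_sum f F \<phi> \<delta> n \<epsilon>) / ereal (real n)" for F \<delta> n \<epsilon>
  define u where "u \<epsilon> = (INF F\<in>nbhds_of \<mu>. limsup (\<lambda>n. q F n \<epsilon>))" for \<epsilon>
  define l where "l \<epsilon> = (INF F\<in>nbhds_of \<mu>. liminf (\<lambda>n. q F n \<epsilon>))" for \<epsilon>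
  define u' where "u' \<epsilon> \<delta> = (INF F\<in>nbhds_of \<mu>. limsup (\<lambda>n. q' F \<delta> n \<epsilon>))" for \<epsilon> \<delta>
  define l' where "l' \<epsilon> \<delta> = (INF F\<in>nbhds_of \<mu>. liminf (\<lambda>n. q' F \<delta> n \<epsilon>))" for \<epsilon> \<delta>
  have q'_anti: "q' F \<delta> n \<epsilon> \<le> q' F \<delta>' n \<epsilon>" if "\<delta>' \<le> \<delta>" "n \<ge> 1" for F \<delta> \<delta>' n \<epsilon>
    unfolding q'_def using that
    by (intro ereal_divide_right_mono ereal_ln_mono delta_sep_sum_mono) auto
  have q'_le_q: "q' F \<delta> n \<epsilon> \<le> q F n \<epsilon>" if "0 < \<delta>" "n \<ge> 1" for F \<delta> n \<epsilon>
    unfolding q_def q'_def using that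
    by (intro ereal_divide_right_mono ereal_ln_mono delta_sep_sum_le_sep_sum) auto
  have u'_anti: "u' \<epsilon> \<delta> \<le> u' \<epsilon> \<delta>'" and l'_anti: "l' \<epsilon> \<delta> \<le> l' \<epsilon> \<delta>'" if "\<delta>' \<le> \<delta>" for \<epsilon> \<delta> \<delta>'
    unfolding u'_def l'_def using q'_anti[OF that]
    by (intro INF_mono' Limsup_mono Liminf_mono eventually_sequentiallyI[of 1]; simp)+
  have u'_le: "u' \<epsilon> \<delta> \<le> u \<epsilon>" and l'_le: "l' \<epsilon> \<delta> \<le> l \<epsilon>" if "0 < \<delta>" for \<epsilon> \<delta>
    unfolding u_def u'_def l_def l'_def using q'_le_q[OF that]
    by (intro INF_mono' Limsup_mono Liminf_mono eventually_sequentiallyI[of 1]; simp)+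
  have l_le: "l \<epsilon> \<le> u \<epsilon>" and l'_le_u': "l' \<epsilon> \<delta> \<le> u' \<epsilon> \<delta>" for \<epsilon> \<delta>
    unfolding l_def u_def l'_def u'_def
    by (intro INF_mono' Liminf_le_Limsup; simp)+
  \<comment> \<open>It is enough to bound the largest quantity \<open>u\<close> from above and the
    smallest, \<open>l'\<close>, from below: \<open>l'\<close> lies below \<open>l\<close> and
    \<open>u'\<close>, and both lie below \<open>u\<close>.\<close>
  have upper: "u \<epsilon> \<le> L" if "0 < \<epsilon>" for \<epsilon>
    unfolding u_def q_def L_def using INF_limsup_sep_sum_le assms that by blast
  have lower: "\<exists>\<delta>0>0. \<exists>\<epsilon>0>0. \<forall>\<delta> \<epsilon>. \<delta> \<le> \<delta>0 \<longrightarrow> \<epsilon> \<le> \<epsilon>0 \<longrightarrow> r \<le> l' \<epsilon> \<delta>" if "r < L" for r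
    using le_INF_liminf_delta_sep_sum[OF assms(1,3,4,5,6), of r] that
    unfolding l'_def q'_def L_def by blast
  \<comment> \<open>Fixing \<delta> at its threshold transfers the lower bound from
    \<open>l'\<close> to \<open>l\<close>.\<close>
  have lower_l: "\<exists>\<epsilon>0>0. \<forall>\<epsilon>. 0 < \<epsilon> \<longrightarrow> \<epsilon> \<le> \<epsilon>0 \<longrightarrow> r \<le> l \<epsilon>" if "r < L" for r
    using lower[OF that] l'_le by (meson order_refl order_trans)
  have "SP_upper f \<phi> \<mu> = Lim (at_right 0) u" "SP_lower f \<phi> \<mu> = Lim (at_right 0) l"
    "SP'_upper f \<phi> \<mu> = Lim (at_right 0) (\<lambda>\<epsilon>. Lim (at_right 0) (u' \<epsilon>))"
    "SP'_lower f \<phi> \<mu> = Lim (at_right 0) (\<lambda>\<epsilon>. Lim (at_right 0) (l' \<epsilon>))"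
    unfolding SP_upper_def SP_lower_def SP'_upper_def SP'_lower_def
      u_def[abs_def] l_def[abs_def] u'_def[abs_def] l'_def[abs_def] q_def q'_def
    by (rule refl)+
  moreover have "Lim (at_right 0) u = L"
    using upper lower_l l_le by (intro Lim_at_right_0_eqI) (meson order_trans)+
  moreover have "Lim (at_right 0) l = L"
    using upper lower_l l_le by (intro Lim_at_right_0_eqI) (meson order_trans)+
  moreover have "Lim (at_right 0) (\<lambda>\<epsilon>. Lim (at_right 0) (u' \<epsilon>)) = L"
    using u'_anti u'_le upper lower l'_le_u' by (intro Lim_Lim_at_right_0_eqI) (meson order_trans)+
  moreover have "Lim (at_right 0) (\<lambda>\<epsilon>. Lim (at_right 0) (l' \<epsilon>)) = L"
    using l'_anti l'_le l_le upper lower by (intro Lim_Lim_at_right_0_eqI) (meson order_trans)+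
  ultimately show ?thesis by (simp add: L_def)
qed

end
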